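(* As $n\to \infty$, we have $$a_2(n)\sim \frac{3^{5/4}}{8\pi n^{1/4}}e^{\pi\sqrt{\frac n3}}\qquad\text{and}\qquad b_2(n)\sim \frac{3^{1/4}}{4\pi n^{1/4}}e^{\pi\sqrt{\frac{n}{3}}}.$$
   Context: A partition $\lambda=(\lambda_1,\dots,\lambda_\ell)$ of $n$ is a non-increasing sequence of positive integers (parts) with sum $n$. Its Young diagram is the left-justified array of boxes with $\lambda_i$ boxes in row $i$; the conjugate $\lambda'$ is the partition whose diagram has the columns of $\lambda$ as rows. The hook length of the box in row $i$ and column $j$ is $h(i,j)=\lambda_i+\lambda'_j-i-j+1$; the number of hooks of length $t$ in $\lambda$ is the number of boxes with hook length exactly $t$. $a_2(n)$ (respectively $b_2(n)$) is the total number of hooks of length $2$ in all partitions of $n$ into odd parts (respectively into distinct parts). $f(n)\sim g(n)$ as $n\to\infty$ means $f(n)/g(n)\to1$. *)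

theory Defs
  imports Complex_Main "HOL-Library.Landau_Symbols"
begin

definition partitions :: "nat \<Rightarrow> nat list set" where
  "partitions n = {l. sorted_wrt (\<ge>) l \<and> (\<forall>p \<in> set l. 0 < p) \<and> sum_list l = n}"

definition odd_partitions :: "nat \<Rightarrow> nat list set" where
  "odd_partitions n = {l \<in> partitions n. \<forall>p \<in> set l. odd p}"

definition distinct_partitions :: "nat \<Rightarrow> nat list set" where
  "distinct_partitions n = {l \<in> partitions n. distinct l}"

text \<open>Parts, rows and columns are numbered from 1, whereas list positions start at 0.\<close>

definition part :: "nat list \<Rightarrow> nat \<Rightarrow> nat" where
  "part l i = l ! (i - 1)"

definition young_diagram :: "nat list \<Rightarrow> (nat \<times> nat) set" where
  "young_diagram l = {(i, j). 1 \<le> i \<and> i \<le> length l \<and> 1 \<le> j \<and> j \<le> part l i}"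

text \<open>The parts of the conjugate are the column lengths; the number of columns is the largest
  (that is, the first) part, or 0 for the empty partition.\<close>

definition conjugate :: "nat list \<Rightarrow> nat list" where
  "conjugate l = map (\<lambda>j. card {i. (i, j) \<in> young_diagram l})
     [1..<Suc (if l = [] then 0 else hd l)]"

definition hook_length :: "nat list \<Rightarrow> nat \<Rightarrow> nat \<Rightarrow> int" where
  "hook_length l i j = int (part l i) + int (part (conjugate l) j) - int i - int j + 1"

definition num_hooks :: "nat \<Rightarrow> nat list \<Rightarrow> nat" where
  "num_hooks t l = card {(i, j). (i, j) \<in> young_diagram l \<and> hook_length l i j = int t}"

definition a2 :: "nat \<Rightarrow> nat" where
  "a2 n = (\<Sum>l \<in> odd_partitions n. num_hooks 2 l)"

definition b2 :: "nat \<Rightarrow> nat" where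
  "b2 n = (\<Sum>l \<in> distinct_partitions n. num_hooks 2 l)"

text \<open>Sums and cardinalities of infinite sets are 0 in HOL; the ones above are all finite.\<close>

lemma finite_partitions: "finite (partitions n)"
proof (rule finite_subset)
  have "length l \<le> sum_list l" if "\<forall>p \<in> set l. 0 < p" for l :: "nat list"
    using that by (induction l) auto
  then show "partitions n \<subseteq> {l. set l \<subseteq> {..n} \<and> length l \<le> n}"
    by (auto simp: partitions_def member_le_sum_list)
  show "finite {l. set l \<subseteq> {..n} \<and> length l \<le> n}"
    by (rule finite_lists_length_le) simp
qed

lemma finite_young_diagram: "finite (young_diagram l)"
proof (rule finite_subset)
  show "young_diagram l \<subseteq> {..length l} \<times> {..sum_list l}"
    by (fastforce simp: young_diagram_def part_def intro: order_trans[OF _ member_le_sum_list])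
qed simp

lemma young_diagram_conjugate:
  assumes "l \<in> partitions n"
  shows "young_diagram (conjugate l) = (young_diagram l)\<inverse>"
proof -
  have anti: "part l k \<le> part l i" if "1 \<le> i" "i \<le> k" "k \<le> length l" for i k
  proof (cases "i = k")
    case False
    then show ?thesis
      using assms that by (auto simp: partitions_def part_def sorted_wrt_iff_nth_less)
  qed simp
  have bound: "j \<le> hd l \<and> l \<noteq> []" if "(i, j) \<in> young_diagram l" for i j
    using that anti[of 1 i]
    by (cases l) (auto simp: young_diagram_def part_def)
  have col: "(i, j) \<in> young_diagram l \<longleftrightarrow> 1 \<le> i \<and> i \<le> card {i. (i, j) \<in> young_diagram l}"
    for i j
  proof -
    define C where "C = {i. (i, j) \<in> young_diagram l}"
    have fin: "finite C"
      by (rule finite_subset[of _ "{..length l}"]) (auto simp: C_def young_diagram_def)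
    have down: "k \<in> C" if "m \<in> C" "1 \<le> k" "k \<le> m" for k m
      using that anti[of k m] by (auto simp: C_def young_diagram_def)
    have pos: "1 \<le> k" if "k \<in> C" for k
      using that by (simp add: C_def young_diagram_def)
    have "C = {1..card C}"
    proof (cases "C = {}")
      case False
      have "C = {1..Max C}"
      proof (intro set_eqI iffI)
        fix k assume "k \<in> C"
        then show "k \<in> {1..Max C}" using pos fin by simp
      next
        fix k assume "k \<in> {1..Max C}"
        then show "k \<in> C" using down[OF Max_in[OF fin False], of k] by simp
      qed
      then have "card C = Max C" by (metis card_atLeastAtMost diff_Suc_1)
      with \<open>C = {1..Max C}\<close> show ?thesis by simp
    qed simp
    then have "i \<in> C \<longleftrightarrow> i \<in> {1..card C}" by (rule arg_cong)
    then show ?thesis by (simp add: C_def)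
  qed
  have len: "length (conjugate l) = (if l = [] then 0 else hd l)"
    by (simp add: conjugate_def)
  have pt: "part (conjugate l) j = card {i. (i, j) \<in> young_diagram l}"
    if "1 \<le> j" "j \<le> length (conjugate l)" for j
    using that by (auto simp: part_def conjugate_def nth_upt simp del: upt_Suc split: if_splits)
  have "(j, i) \<in> young_diagram (conjugate l) \<longleftrightarrow> (i, j) \<in> young_diagram l" for i j
  proof
    assume "(j, i) \<in> young_diagram (conjugate l)"
    then have "1 \<le> j" "j \<le> length (conjugate l)" "1 \<le> i" "i \<le> part (conjugate l) j"
      unfolding young_diagram_def[of "conjugate l"] by auto
    then show "(i, j) \<in> young_diagram l"
      using col[of i j] pt[of j] by simp
  next
    assume ij: "(i, j) \<in> young_diagram l"
    then have "1 \<le> j" by (simp add: young_diagram_def)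
    moreover have "j \<le> length (conjugate l)" using bound[OF ij] by (simp add: len)
    ultimately show "(j, i) \<in> young_diagram (conjugate l)"
      using col[of i j] ij pt[of j] unfolding young_diagram_def[of "conjugate l"] by simp
  qed
  then show ?thesis by auto
qed

end

theory Submission
  imports Defs
    "HOL-Library.Multiset"
    "HOL-Complex_Analysis.Cauchy_Integral_Formula"
    "HOL-Probability.Sinc_Integral"
    "HOL-Real_Asymp.Real_Asymp"
begin

text \<open>
  A box of a Young diagram has hook length 2 exactly when one of its arm and leg lengths is 1 and the
  other 0. Hooks with arm 1 correspond to the part sizes \<open>p \<ge> 2\<close> such that
  \<open>p - 1\<close> is not a part, hooks with leg 1 to the part sizes that are repeated
  (\<open>num_hooks_2\<close>). Counting pairs of a partition and such a size turns both totals into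
  convolutions. For odd parts, removing the one or two copies of \<open>p\<close> leaves an arbitrary
  partition into odd parts (\<open>a2_eq_convolution\<close>). For distinct parts, replacing
  \<open>p\<close> by \<open>p - 1\<close> makes a sum over \<open>p\<close> telescope, and what
  remains is the recurrence \<open>b2 (n + 2) = b2 n + D n\<close>, where \<open>D n\<close>
  is the number of partitions of \<open>n\<close> into distinct parts
  (\<open>b2_eq_convolution\<close>). The weights in these convolutions are indicators of arithmetic
  progressions, so their power series at \<open>q = exp (- z)\<close> behave like
  \<open>\<kappa> / z\<close> for \<open>z \<rightarrow> 0\<close>, with
  \<open>\<kappa> = 1/2 + 1/4\<close> for \<open>a2\<close> and \<open>\<kappa> = 1/2\<close> for
  \<open>b2\<close>.

  By Euler's theorem the partitions into odd parts and those into distinct parts have the same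
  generating function \<open>exp (L q)\<close>, where
  \<open>L q = (\<Sum>m\<ge>1. q^m / (m * (1 - q^(2*m))))\<close>. Two properties of
  \<open>L\<close> carry the analysis. All terms of this series have nonnegative coefficients, so on a
  circle the modulus of \<open>exp (L q)\<close> is largest at the positive point; already the term
  \<open>m = 1\<close> shows by how much it drops elsewhere (\<open>norm_exp_partition_log_le\<close>,
  \<open>Re_deficit_ge\<close>). Near \<open>q = 1\<close>, \<open>L (exp (- z)) = \<pi>\<^sup>2 / (12
  * z) - ln 2 / 2 + o(1)\<close> in the sector \<open>\<bar>Im z\<bar> \<le> Re z\<close>
  (\<open>partition_log_asymptotics\<close>).

  The asymptotics then follow by the saddle point method (\<open>convolution_asymptotics\<close>). The
  coefficient of \<open>q^n\<close> is an integral over the circle of radius \<open>exp (- t)\<close>,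
  and \<open>t = \<pi> / sqrt (12 * n)\<close> minimises
  \<open>\<pi>\<^sup>2 / (12 * t) + n * t\<close>. After the substitution
  \<open>\<theta> = t powr (3/2) * u\<close> the normalised integrand converges pointwise to
  \<open>\<kappa> / sqrt 2 * exp (- \<pi>\<^sup>2 * u\<^sup>2 / 12)\<close>. The drop of the modulus
  bounds it on the whole circle by a constant multiple of \<open>1 / (1 + u\<^sup>2)\<close>, so
  that a single application of dominated convergence covers both the neighbourhood of the saddle point
  and the rest of the circle.
\<close>

section \<open>Hooks of length two\<close>

text \<open>The column lengths of the diagram, that is, the parts of the conjugate, in a form that is
  easy to follow when a largest part is put in front of a list.\<close>

definition at_least :: "nat \<Rightarrow> nat list \<Rightarrow> nat" where
  "at_least j l = length (filter (\<lambda>x. j \<le> x) l)"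

text \<open>Here rows are numbered from 0, and the condition on the position says that arm and leg add
  up to 1. In this form, putting a new first row on top of a diagram only shifts the hooks of the old
  rows, which makes induction on the list of parts possible.\<close>

lemma num_hooks_eq_card_positions:
  assumes "l \<in> partitions n"
  shows "num_hooks 2 l = card {(i, j). i < length l \<and> 1 \<le> j \<and> j \<le> l ! i \<and> l ! i + at_least j l
      = i + j + 2}"
proof -
  have anti: "l ! k \<le> l ! i" if "i \<le> k" "k < length l" for i k
    using assms that by (cases "i = k") (auto simp: partitions_def sorted_wrt_iff_nth_less)
  have conj: "Defs.part (conjugate l) j = at_least j l" if ij: "(i, j) \<in> young_diagram l" for i j
  proof -
    have i: "1 \<le> i" "i \<le> length l" and "1 \<le> j" and j: "j \<le> l ! (i - 1)"
      using ij unfolding young_diagram_def Defs.part_def by blast+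
    then have "l \<noteq> []" by auto
    moreover have "i - 1 < length l" using i by linarith
    then have "j \<le> l ! 0" using anti[of 0 "i - 1"] j by linarith
    ultimately have "j \<le> hd l" "l \<noteq> []" by (simp_all add: hd_conv_nth)
    with \<open>1 \<le> j\<close> have "Defs.part (conjugate l) j = card {i. (i, j) \<in> young_diagram l}"
      by (auto simp: Defs.part_def conjugate_def nth_upt simp del: upt_Suc)
    also have "{i. (i, j) \<in> young_diagram l} = Suc ` {i. i < length l \<and> j \<le> l ! i}"
    proof (intro set_eqI iffI)
      fix k assume "k \<in> {i. (i, j) \<in> young_diagram l}"
      then have "k - 1 \<in> {i. i < length l \<and> j \<le> l ! i}" "k = Suc (k - 1)"
        by (auto simp: young_diagram_def Defs.part_def)
      then show "k \<in> Suc ` {i. i < length l \<and> j \<le> l ! i}" by blast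
    qed (use \<open>1 \<le> j\<close> in \<open>auto simp: young_diagram_def Defs.part_def\<close>)
    also have "card \<dots> = at_least j l"
      by (simp add: card_image at_least_def length_filter_conv_card)
    finally show ?thesis .
  qed
  let ?f = "\<lambda>(i, j). (Suc i, j::nat)"
  let ?H = "{(i, j). i < length l \<and> 1 \<le> j \<and> j \<le> l ! i \<and> l ! i + at_least j l = i + j + 2}"
  have "{(i, j). (i, j) \<in> young_diagram l \<and> hook_length l i j = int 2} = ?f ` ?H"
  proof (intro set_eqI iffI)
    fix p assume "p \<in> {(i, j). (i, j) \<in> young_diagram l \<and> hook_length l i j = int 2}"
    then obtain i j where p: "p = (i, j)" "(i, j) \<in> young_diagram l" "hook_length l i j = 2" by auto
    then have "(i - 1, j) \<in> ?H" "i = Suc (i - 1)"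
      using conj[OF p(2)] by (auto simp: hook_length_def young_diagram_def Defs.part_def)
    then show "p \<in> ?f ` ?H" using p(1) by (auto intro!: image_eqI[of _ _ "(i - 1, j)"])
  next
    fix p assume "p \<in> ?f ` ?H"
    then obtain i j where p: "p = (Suc i, j)" and H: "(i, j) \<in> ?H" by auto
    from H have Y: "(Suc i, j) \<in> young_diagram l" by (auto simp: young_diagram_def Defs.part_def)
    then show "p \<in> {(i, j). (i, j) \<in> young_diagram l \<and> hook_length l i j = int 2}"
      using conj[OF Y] H p by (auto simp: hook_length_def Defs.part_def)
  qed
  moreover have "inj_on ?f ?H" by (auto simp: inj_on_def)
  ultimately show ?thesis by (simp add: num_hooks_def card_image)
qed

text \<open>Arm and leg of a box depend only on its own row and the rows below, so a new first row of
  length \<open>x\<close> adds only the hooks that start in it. The corner of such a hook lies either in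
  column \<open>x\<close>, where it needs exactly one further part equal to \<open>x\<close>, or in
  column \<open>x - 1\<close>, where no part below may reach that column. On the other side,
  \<open>x\<close> becomes a repeated size in the first case and a new size whose predecessor is missing
  in the second.\<close>

lemma card_hook_positions:
  assumes "sorted_wrt (\<ge>) l" "\<forall>p\<in>set l. 0 < p"
  shows "card {(i, j). i < length l \<and> 1 \<le> j \<and> j \<le> l ! i \<and> l ! i + at_least j l = i + j + 2}
     = card {p \<in> set l. 2 \<le> p \<and> p - 1 \<notin> set l} + card {p. 2 \<le> count (mset l) p}"
  using assms
proof (induction l)
  case Nil
  then show ?case by simp
next
  case (Cons x l)
  let ?H = "\<lambda>l. {(i, j). i < length l \<and> 1 \<le> j \<and> j \<le> l ! i \<and> l ! i + at_least j l = i + j + 2}"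
  let ?P = "\<lambda>l. {p \<in> set l. 2 \<le> p \<and> p - 1 \<notin> set l}"
  let ?Q = "\<lambda>l. {p. 2 \<le> count (mset l) p}"
  have le: "y \<le> x" if "y \<in> set l" for y using Cons.prems that by auto
  have x: "0 < x" using Cons.prems by auto
  let ?J = "{j. 1 \<le> j \<and> j \<le> x \<and> x + at_least j l = j + 1}"
  have al: "at_least j (x # l) = Suc (at_least j l)" if "j \<le> x" for j
    using that by (simp add: at_least_def)
  have H: "?H (x # l) = Pair (0::nat) ` ?J \<union> (\<lambda>(i, j). (Suc i, j)) ` ?H l"
  proof (intro set_eqI iffI)
    fix p assume "p \<in> ?H (x # l)"
    then obtain i j where p: "p = (i, j)" "i < Suc (length l)" "1 \<le> j" "j \<le> (x # l) ! i"
       "(x # l) ! i + at_least j (x # l) = i + j + 2" by auto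
    show "p \<in> Pair (0::nat) ` ?J \<union> (\<lambda>(i, j). (Suc i, j)) ` ?H l"
    proof (cases i)
      case 0
      then have "j \<in> ?J" using p al[of j] by auto
      then show ?thesis using p 0 by auto
    next
      case (Suc k)
      then have "j \<le> x" using p le[of "l ! k"] by auto
      then have "(k, j) \<in> ?H l" using p Suc al[of j] by auto
      then show ?thesis using p Suc by force
    qed
  next
    fix p assume "p \<in> Pair (0::nat) ` ?J \<union> (\<lambda>(i, j). (Suc i, j)) ` ?H l"
    then show "p \<in> ?H (x # l)"
    proof
      assume "p \<in> Pair (0::nat) ` ?J"
      then show ?thesis using al by auto
    next
      assume "p \<in> (\<lambda>(i, j). (Suc i, j)) ` ?H l"
      then obtain i j where ij: "p = (Suc i, j)" "(i, j) \<in> ?H l" by auto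
      then have "j \<le> x" using le[of "l ! i"] by auto
      then show ?thesis using ij al[of j] by auto
    qed
  qed
  have finH: "finite (?H l)"
  proof (rule finite_subset)
    show "?H l \<subseteq> {..<length l} \<times> {..x}" using le by (fastforce dest: nth_mem)
  qed simp
  have finJ: "finite ?J" by (rule finite_subset[of _ "{..x}"]) auto
  have "card (?H (x # l)) = card (Pair (0::nat) ` ?J) + card ((\<lambda>(i, j). (Suc i, j)) ` ?H l)"
    unfolding H using finH finJ by (intro card_Un_disjoint) auto
  also have "\<dots> = card ?J + card (?H l)"
    by (intro arg_cong2[where f = "(+)"] card_image) (auto simp: inj_on_def)
  finally have cH: "card (?H (x # l)) = card ?J + card (?H l)" .
  have atx: "at_least x l = count (mset l) x"
  proof -
    have "filter ((\<le>) x) l = filter ((=) x) l" using le by (intro filter_cong) (auto intro: antisym)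
    then show ?thesis by (simp add: at_least_def count_mset count_list_eq_length_filter)
  qed
  have J: "?J = (if count (mset l) x = 1 then {x} else {}) \<union>
                (if 2 \<le> x \<and> x \<notin> set l \<and> x - 1 \<notin> set l then {x - 1} else {})"
  proof -
    have low: "at_least (x - 1) l = 0 \<longleftrightarrow> x \<notin> set l \<and> x - 1 \<notin> set l"
    proof -
      have "at_least (x - 1) l = 0 \<longleftrightarrow> (\<forall>y\<in>set l. \<not> x - 1 \<le> y)"
        by (simp add: at_least_def filter_empty_conv)
      also have "\<dots> \<longleftrightarrow> x \<notin> set l \<and> x - 1 \<notin> set l"
        using le by (metis diff_le_self le_antisym le_diff_conv not_less_eq_eq order_refl Suc_eq_plus1)
      finally show ?thesis .
    qed
    have "j \<in> ?J \<longleftrightarrow> (j = x \<and> at_least x l = 1) \<or> (j = x - 1 \<and> 2 \<le> x \<and> at_least (x - 1) l = 0)" for j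
    proof
      assume "j \<in> ?J"
      then have j: "1 \<le> j" "j \<le> x" "x + at_least j l = j + 1" by auto
      then have "j = x \<or> j = x - 1" by linarith
      then show "(j = x \<and> at_least x l = 1) \<or> (j = x - 1 \<and> 2 \<le> x \<and> at_least (x - 1) l = 0)"
        using j by auto
    qed (use x in auto)
    then show ?thesis using x unfolding low atx by (auto split: if_splits)
  qed
  have cP: "?P (x # l) = (if 2 \<le> x \<and> x \<notin> set l \<and> x - 1 \<notin> set l then insert x (?P l) else ?P l)"
  proof (cases "x \<in> set l")
    case True
    then show ?thesis by (simp add: insert_absorb)
  next
    case False
    have "p - 1 \<noteq> x" if "p \<in> set (x # l)" for p
      using that le[of p] x by auto
    then show ?thesis using False by auto
  qed
  have cQ: "?Q (x # l) = (if count (mset l) x = 1 then insert x (?Q l) else ?Q l)"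
  proof -
    define c where "c = count (mset l)"
    have E: "count (mset (x # l)) p = (if p = x then Suc (c p) else c p)" for p
      by (simp add: c_def)
    show ?thesis unfolding E c_def[symmetric] by auto
  qed
  have fP: "finite (?P l)" by simp
  have fQ: "finite (?Q l)"
  proof (rule finite_subset)
    show "?Q l \<subseteq> set l"
    proof
      fix p assume "p \<in> ?Q l"
      then have "2 \<le> count (mset l) p" by (rule CollectD)
      then have "0 < count (mset l) p" by linarith
      then show "p \<in> set l" by (simp only: count_greater_zero_iff set_mset_mset)
    qed
  qed simp
  have IH: "card (?H l) = card (?P l) + card (?Q l)" using Cons by simp
  consider "count (mset l) x = 0" "x \<notin> set l" | "count (mset l) x = 1" "x \<in> set l"
    | "2 \<le> count (mset l) x" "x \<in> set l"
  proof (cases "x \<in> set l")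
    case True
    then have "0 < count (mset l) x" by simp
    then have "count (mset l) x = 1 \<or> 2 \<le> count (mset l) x" by linarith
    then show ?thesis using that True by blast
  next
    case False
    then have "count (mset l) x = 0" by (simp add: count_eq_zero_iff)
    then show ?thesis using that False by blast
  qed
  then show ?case
  proof cases
    case 1
    then show ?thesis unfolding cH IH cP cQ J using fP fQ by auto
  next
    case 2
    then show ?thesis unfolding cH IH cP cQ J using fP fQ by auto
  next
    case 3
    then show ?thesis unfolding cH IH cP cQ J using fP fQ by auto
  qed
qed

text \<open>The first summand counts the hooks with arm 1 and leg 0, the second those with arm 0 and leg
  1.\<close>

lemma num_hooks_2:
  assumes "l \<in> partitions n"
  shows "num_hooks 2 l = card {p \<in> set l. 2 \<le> p \<and> p - 1 \<notin> set l} + card {p. 2 \<le> count (mset l) p}"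
  using num_hooks_eq_card_positions[OF assms] card_hook_positions[of l] assms
      by (simp add: partitions_def)

section \<open>Hook totals as convolutions\<close>

lemma rev_sorted_list_of_multiset_mset:
  fixes l :: "nat list"
  assumes "sorted_wrt (\<ge>) l"
  shows "rev (sorted_list_of_multiset (mset l)) = l"
proof -
  have "sorted (rev l)" using assms by (simp add: sorted_wrt_rev)
  then have "sorted_list_of_multiset (mset (rev l)) = rev l"
    by (simp only: sorted_list_of_multiset_mset sorted_sort_id)
  then show ?thesis by simp
qed

text \<open>Weakly decreasing lists of odd parts, with the order forgotten: adding and removing parts is
  simpler for multisets than for sorted lists. Sets play the same role for distinct parts.\<close>

definition odd_multisets :: "nat \<Rightarrow> nat multiset set" where
  "odd_multisets n = {M. (\<forall>p\<in>#M. odd p) \<and> sum_mset M = n}"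

definition distinct_sets :: "nat \<Rightarrow> nat set set" where
  "distinct_sets n = {S. finite S \<and> 0 \<notin> S \<and> \<Sum>S = n}"

lemma bij_mset_odd_partitions: "bij_betw mset (odd_partitions n) (odd_multisets n)"
proof (rule bij_betw_byWitness[where f' = "\<lambda>M. rev (sorted_list_of_multiset M)"])
  show "\<forall>l\<in>odd_partitions n. rev (sorted_list_of_multiset (mset l)) = l"
    by (intro ballI rev_sorted_list_of_multiset_mset) (simp add: odd_partitions_def partitions_def)
  show "\<forall>M\<in>odd_multisets n. mset (rev (sorted_list_of_multiset M)) = M"
    by simp
  show "mset ` odd_partitions n \<subseteq> odd_multisets n"
    by (auto simp: odd_partitions_def partitions_def odd_multisets_def sum_mset_sum_list)
  show "(\<lambda>M. rev (sorted_list_of_multiset M)) ` odd_multisets n \<subseteq> odd_partitions n"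
  proof (safe, unfold odd_partitions_def partitions_def mem_Collect_eq, intro conjI)
    fix M assume M: "M \<in> odd_multisets n"
    let ?l = "rev (sorted_list_of_multiset M)"
    show "sorted_wrt (\<ge>) ?l" by (simp add: sorted_wrt_rev sorted_sorted_list_of_multiset)
    show "\<forall>p\<in>set ?l. odd p" using M by (simp add: odd_multisets_def)
    then show "\<forall>p\<in>set ?l. 0 < p" by (auto intro!: odd_pos)
    have "sum_list ?l = sum_mset (mset ?l)" by (rule sum_mset_sum_list[symmetric])
    then show "sum_list ?l = n" using M by (simp add: odd_multisets_def)
  qed
qed

lemma bij_set_distinct_partitions: "bij_betw set (distinct_partitions n) (distinct_sets n)"
proof (rule bij_betw_byWitness[where f' = "\<lambda>S. rev (sorted_list_of_set S)"])
  show "\<forall>l\<in>distinct_partitions n. rev (sorted_list_of_set (set l)) = l"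
  proof
    fix l assume l: "l \<in> distinct_partitions n"
    then have "sorted (rev l)" "distinct (rev l)"
      by (auto simp: distinct_partitions_def partitions_def sorted_wrt_rev)
    then have "sorted_list_of_set (set (rev l)) = rev l"
      by (rule sorted_list_of_set.idem_if_sorted_distinct)
    then show "rev (sorted_list_of_set (set l)) = l" by simp
  qed
  show "\<forall>S\<in>distinct_sets n. set (rev (sorted_list_of_set S)) = S"
    by (simp add: distinct_sets_def)
  show "set ` distinct_partitions n \<subseteq> distinct_sets n"
    by (auto simp: distinct_partitions_def partitions_def distinct_sets_def distinct_sum_list_conv_Sum)
  show "(\<lambda>S. rev (sorted_list_of_set S)) ` distinct_sets n \<subseteq> distinct_partitions n"
  proof (safe, unfold distinct_partitions_def partitions_def mem_Collect_eq, intro conjI)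
    fix S assume S: "S \<in> distinct_sets n"
    let ?l = "rev (sorted_list_of_set S)"
    show "sorted_wrt (\<ge>) ?l" by (simp add: sorted_wrt_rev)
    show "distinct ?l" by simp
    then have "sum_list ?l = \<Sum>(set ?l)" by (rule distinct_sum_list_conv_Sum)
    then show "sum_list ?l = n" using S by (simp add: distinct_sets_def)
    show "\<forall>p\<in>set ?l. 0 < p" using S by (auto simp: distinct_sets_def intro: gr0I)
  qed
qed

lemma finite_odd_multisets: "finite (odd_multisets n)"
  using bij_betw_finite[OF bij_mset_odd_partitions[of n]] finite_partitions[of n]
  by (auto simp: odd_partitions_def)

lemma finite_distinct_sets: "finite (distinct_sets n)"
  using bij_betw_finite[OF bij_set_distinct_partitions[of n]] finite_partitions[of n]
  by (auto simp: distinct_partitions_def)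

text \<open>Double counting of the pairs in a relation.\<close>

lemma sum_card_swap:
  assumes "finite A" "\<And>x p. x \<in> A \<Longrightarrow> R x p \<Longrightarrow> p \<in> B" "finite B"
  shows "(\<Sum>x\<in>A. card {p. R x p}) = (\<Sum>p\<in>B. card {x \<in> A. R x p})"
proof -
  have "(\<Sum>x\<in>A. card {p. R x p}) = (\<Sum>x\<in>A. card {p \<in> B. R x p})"
    using assms(2) by (intro sum.cong refl arg_cong[where f = card]) auto
  also have "\<dots> = (\<Sum>x\<in>A. \<Sum>p\<in>B. of_bool (R x p))"
    using assms(3) by (simp add: Int_def)
  also have "\<dots> = (\<Sum>p\<in>B. \<Sum>x\<in>A. of_bool (R x p))" by (rule sum.swap)
  also have "\<dots> = (\<Sum>p\<in>B. card {x \<in> A. R x p})"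
    using assms(1) by (simp add: Int_def)
  finally show ?thesis .
qed

definition odd_count :: "nat \<Rightarrow> nat" where
  "odd_count n = card (odd_multisets n)"

definition distinct_count :: "nat \<Rightarrow> nat" where
  "distinct_count n = card (distinct_sets n)"

lemma sum_mset_replicate_nat: "sum_mset (replicate_mset k p) = k * (p::nat)"
  by (induction k) auto

lemma remove_replicate_mset:
  assumes "k \<le> count M (p::nat)"
  shows "M - replicate_mset k p + replicate_mset k p = M"
    and "sum_mset M = k * p + sum_mset (M - replicate_mset k p)"
proof -
  show eq: "M - replicate_mset k p + replicate_mset k p = M"
    using assms by (simp add: count_le_replicate_mset_subset_eq)
  have "sum_mset (M - replicate_mset k p + replicate_mset k p) = sum_mset M"
    by (rule arg_cong[OF eq])
  then show "sum_mset M = k * p + sum_mset (M - replicate_mset k p)"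
    by (simp only: sum_mset.union sum_mset_replicate_nat add.commute)
qed

text \<open>Removing \<open>k\<close> copies of \<open>p\<close> is a bijection onto the partitions of
  \<open>n - k * p\<close> into odd parts.\<close>

lemma card_odd_multisets_count_ge:
  assumes k: "0 < k"
  shows "card {M \<in> odd_multisets n. k \<le> count M p} = (if odd p \<and> k * p
      \<le> n then odd_count (n - k * p) else 0)"
proof (cases "odd p \<and> k * p \<le> n")
  case True
  have "bij_betw (\<lambda>M. M + replicate_mset k p) (odd_multisets (n - k * p)) {M \<in> odd_multisets n. k
      \<le> count M p}"
  proof (rule bij_betw_byWitness[where f' = "\<lambda>M. M - replicate_mset k p"])
    show "(\<lambda>M. M + replicate_mset k p) ` odd_multisets (n - k * p) \<subseteq> {M \<in> odd_multisets n. k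
        \<le> count M p}"
    proof (intro image_subsetI CollectI conjI)
      fix M assume M: "M \<in> odd_multisets (n - k * p)"
      show "M + replicate_mset k p \<in> odd_multisets n"
        using M True by (simp add: odd_multisets_def sum_mset_replicate_nat ball_Un)
    qed simp
    show "(\<lambda>M. M - replicate_mset k p) ` {M \<in> odd_multisets n. k \<le> count M p}
        \<subseteq> odd_multisets (n - k * p)"
    proof safe
      fix M assume M: "M \<in> odd_multisets n" "k \<le> count M p"
      have "sum_mset M = k * p + sum_mset (M - replicate_mset k p)"
        by (rule remove_replicate_mset(2)[OF M(2)])
      moreover have "sum_mset M = n" using M(1) by (simp add: odd_multisets_def)
      ultimately have "sum_mset (M - replicate_mset k p) = n - k * p" by linarith
      moreover have "odd x" if "x \<in># M - replicate_mset k p" for x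
        using in_diffD[OF that] M(1) by (simp add: odd_multisets_def)
      ultimately show "M - replicate_mset k p \<in> odd_multisets (n - k * p)"
        by (simp add: odd_multisets_def)
    qed
  qed (simp_all add: remove_replicate_mset(1))
  from bij_betw_same_card[OF this] show ?thesis using True by (simp add: odd_count_def)
next
  case False
  have "{M \<in> odd_multisets n. k \<le> count M p} = {}"
  proof safe
    fix M assume M: "M \<in> odd_multisets n" "k \<le> count M p"
    then have "0 < count M p" using k by linarith
    then have "p \<in># M" by simp
    then have "odd p" using M by (auto simp: odd_multisets_def)
    moreover have "k * p \<le> n" using remove_replicate_mset(2)[OF M(2)] M(1)
        by (simp add: odd_multisets_def)
    ultimately show "M \<in> {}" using False by simp
  qed
  then show ?thesis using False by (auto simp: card_eq_0_iff)
qed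

text \<open>When all parts are odd, the predecessor of a part is never a part, so every size \<open>p
  \<ge> 3\<close> gives a hook; these sizes contribute the weight at \<open>k = p\<close>. A repeated
  size \<open>p\<close> contributes the weight at \<open>k = 2 * p\<close>, which is where the
  numbers congruent to 2 modulo 4 come from.\<close>

lemma a2_eq_convolution:
  "a2 n = (\<Sum>k\<le>n. (of_bool (odd k \<and> 3 \<le> k) + of_bool (even k \<and> odd (k div 2))) * odd_count (n - k))"
proof -
  have hooks: "num_hooks 2 l = card {p. 3 \<le> p \<and> 1 \<le> count (mset l) p} + card {p. 2 \<le> count (mset l) p}"
    if "l \<in> odd_partitions n" for l
  proof -
    have odd_mem: "odd x" if "x \<in> set l" for x
      using \<open>l \<in> odd_partitions n\<close> that by (simp add: odd_partitions_def)
    have "{p \<in> set l. 2 \<le> p \<and> p - 1 \<notin> set l} = {p. 3 \<le> p \<and> 1 \<le> count (mset l) p}"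
    proof (intro set_eqI iffI)
      fix p assume "p \<in> {p \<in> set l. 2 \<le> p \<and> p - 1 \<notin> set l}"
      then have p: "p \<in> set l" "2 \<le> p" "odd p" using odd_mem by simp_all
      then have "p \<noteq> 2" by auto
      then show "p \<in> {p. 3 \<le> p \<and> 1 \<le> count (mset l) p}" using p by simp
    next
      fix p assume "p \<in> {p. 3 \<le> p \<and> 1 \<le> count (mset l) p}"
      then have p: "p \<in> set l" "3 \<le> p" by simp_all
      have "p - 1 \<notin> set l"
      proof
        assume "p - 1 \<in> set l"
        then have "odd (p - 1)" by (rule odd_mem)
        then show False using odd_mem[OF p(1)] p(2) by presburger
      qed
      then show "p \<in> {p \<in> set l. 2 \<le> p \<and> p - 1 \<notin> set l}" using p by simp
    qed
    moreover have "l \<in> partitions n" using that by (simp add: odd_partitions_def)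
    ultimately show ?thesis using num_hooks_2[of l n] by (simp only:)
  qed
  have "a2 n = (\<Sum>l\<in>odd_partitions n. card {p. 3 \<le> p \<and> 1 \<le> count (mset l) p} + card {p. 2
      \<le> count (mset l) p})"
    unfolding a2_def by (intro sum.cong refl hooks)
  also have "\<dots> = (\<Sum>M\<in>odd_multisets n. card {p. 3 \<le> p \<and> 1 \<le> count M p} + card {p. 2 \<le> count M p})"
    by (rule sum.reindex_bij_betw[OF bij_mset_odd_partitions,
          where g = "\<lambda>M. card {p. 3 \<le> p \<and> 1 \<le> count M p} + card {p. 2 \<le> count M p}"])
  also have "\<dots> = (\<Sum>p\<le>n. card {M \<in> odd_multisets n. 3 \<le> p \<and> 1
      \<le> count M p}) + (\<Sum>p\<le>n. card {M \<in> odd_multisets n. 2 \<le> count M p})"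
  proof -
    have b: "p \<in> {..n}" if "M \<in> odd_multisets n" "1 \<le> count M p" for M p
      using remove_replicate_mset(2)[OF that(2)] that(1) by (simp add: odd_multisets_def)
    have b': "p \<in> {..n}" if "M \<in> odd_multisets n" "2 \<le> count M p" for M p
      by (rule b[OF that(1)]) (use that(2) in linarith)
    have "(\<Sum>M\<in>odd_multisets n. card {p. 3 \<le> p \<and> 1 \<le> count M p})
        = (\<Sum>p\<le>n. card {M \<in> odd_multisets n. 3 \<le> p \<and> 1 \<le> count M p})"
      using finite_odd_multisets b by (intro sum_card_swap) blast+
    moreover have "(\<Sum>M\<in>odd_multisets n. card {p. 2 \<le> count M p})
        = (\<Sum>p\<le>n. card {M \<in> odd_multisets n. 2 \<le> count M p})"
      using finite_odd_multisets b' by (intro sum_card_swap) blast+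
    ultimately show ?thesis by (simp only: sum.distrib)
  qed
  also have "(\<Sum>p\<le>n. card {M \<in> odd_multisets n. 3 \<le> p \<and> 1 \<le> count M p}) = (\<Sum>p\<le>n. of_bool (odd p \<and> 3
      \<le> p) * odd_count (n - p))"
  proof (rule sum.cong[OF refl])
    fix p assume "p \<in> {..n}"
    then show "card {M \<in> odd_multisets n. 3 \<le> p \<and> 1 \<le> count M p} = of_bool (odd p \<and> 3
        \<le> p) * odd_count (n - p)"
      using card_odd_multisets_count_ge[of 1 n p] by (cases "3 \<le> p") auto
  qed
  also have "(\<Sum>p\<le>n. card {M \<in> odd_multisets n. 2 \<le> count M p})
      = (\<Sum>k\<le>n. of_bool (even k \<and> odd (k div 2)) * odd_count (n - k))"
  proof -
    have "(\<Sum>p\<le>n. card {M \<in> odd_multisets n. 2 \<le> count M p}) = (\<Sum>p\<in>{p. odd p \<and> 2 * p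
        \<le> n}. odd_count (n - 2 * p))"
      unfolding card_odd_multisets_count_ge[OF zero_less_numeral]
      by (intro sum.mono_neutral_cong_right) auto
    also have "\<dots> = (\<Sum>k\<in>{k. k \<le> n \<and> even k \<and> odd (k div 2)}. odd_count (n - k))"
      by (rule sum.reindex_bij_witness[where i = "\<lambda>k. k div 2" and j = "\<lambda>p. 2 * p"]) auto
    also have "\<dots> = (\<Sum>k\<le>n. of_bool (even k \<and> odd (k div 2)) * odd_count (n - k))"
      by (intro sum.mono_neutral_cong_left) auto
    finally show ?thesis .
  qed
  finally show ?thesis by (simp only: sum.distrib[symmetric] distrib_right)
qed

lemma part_le_size:
  assumes "S \<in> distinct_sets n" "p \<in> S"
  shows "p \<le> n"
  using assms member_le_sum[of p S "\<lambda>x. x"] by (auto simp: distinct_sets_def)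

text \<open>Replacing the part \<open>p\<close> by \<open>p - 1\<close>.\<close>

lemma card_replace_part:
  assumes p: "2 \<le> p"
  shows "card {S \<in> distinct_sets (Suc n). p \<in> S \<and> p - 1 \<notin> S}
      = card {S \<in> distinct_sets n. p \<notin> S \<and> p - 1 \<in> S}"
proof -
  have "bij_betw (\<lambda>S. insert (p - 1) (S - {p})) {S \<in> distinct_sets (Suc n). p \<in> S \<and> p - 1 \<notin> S}
     {S \<in> distinct_sets n. p \<notin> S \<and> p - 1 \<in> S}"
  proof (rule bij_betw_byWitness[where f' = "\<lambda>S. insert p (S - {p - 1})"])
    show "(\<lambda>S. insert (p - 1) (S - {p})) ` {S \<in> distinct_sets (Suc n). p \<in> S \<and> p - 1 \<notin> S}
        \<subseteq> {S \<in> distinct_sets n. p \<notin> S \<and> p - 1 \<in> S}"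
      using p by (auto simp: distinct_sets_def sum.insert_if sum.remove)
    show "(\<lambda>S. insert p (S - {p - 1})) ` {S \<in> distinct_sets n. p \<notin> S \<and> p - 1 \<in> S}
        \<subseteq> {S \<in> distinct_sets (Suc n). p \<in> S \<and> p - 1 \<notin> S}"
      using p by (auto simp: distinct_sets_def sum.insert_if sum.remove)
  qed (use p in auto)
  then show ?thesis by (rule bij_betw_same_card)
qed

lemma b2_eq_sum:
  "b2 n = (\<Sum>p\<in>{2..n}. card {S \<in> distinct_sets n. p \<in> S \<and> p - 1 \<notin> S})"
proof -
  have hooks: "num_hooks 2 l = card {p. 2 \<le> p \<and> p \<in> set l \<and> p - 1 \<notin> set l}"
      if "l \<in> distinct_partitions n" for l
  proof -
    have "distinct l" using that by (simp add: distinct_partitions_def)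
    then have "count (mset l) p \<le> 1" for p
      by (metis distinct_count_atmost_1 le_numeral_extra(4) zero_le_one)
    then have "\<not> 2 \<le> count (mset l) p" for p
      by (metis Suc_1 not_less_eq_eq One_nat_def)
    then have "{p. 2 \<le> count (mset l) p} = {}" by blast
    moreover have "{p \<in> set l. 2 \<le> p \<and> p - 1 \<notin> set l} = {p. 2 \<le> p \<and> p \<in> set l \<and> p - 1 \<notin> set l}" by auto
    ultimately show ?thesis using num_hooks_2[of l n] that by (simp add: distinct_partitions_def)
  qed
  have "b2 n = (\<Sum>l\<in>distinct_partitions n. card {p. 2 \<le> p \<and> p \<in> set l \<and> p - 1 \<notin> set l})"
    unfolding b2_def by (intro sum.cong refl hooks)
  also have "\<dots> = (\<Sum>S\<in>distinct_sets n. card {p. 2 \<le> p \<and> p \<in> S \<and> p - 1 \<notin> S})"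
    by (rule sum.reindex_bij_betw[OF bij_set_distinct_partitions,
          where g = "\<lambda>S. card {p. 2 \<le> p \<and> p \<in> S \<and> p - 1 \<notin> S}"])
  also have "\<dots> = (\<Sum>p\<in>{2..n}. card {S \<in> distinct_sets n. 2 \<le> p \<and> p \<in> S \<and> p - 1 \<notin> S})"
    by (rule sum_card_swap) (use finite_distinct_sets part_le_size in auto)
  also have "\<dots> = (\<Sum>p\<in>{2..n}. card {S \<in> distinct_sets n. p \<in> S \<and> p - 1 \<notin> S})"
    by (rule sum.cong) auto
  finally show ?thesis .
qed

text \<open>Write \<open>M p\<close> for the number of partitions of \<open>n\<close> into distinct
  parts that avoid \<open>p\<close>, and \<open>N p\<close> for the number of those that contain
  \<open>p\<close> but not \<open>p - 1\<close>. Exchanging \<open>p\<close> for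
  \<open>p - 1\<close> in a partition of \<open>n + 1\<close> shows that the analogue of
  \<open>N p\<close> for \<open>n + 1\<close> exceeds \<open>N p\<close> by
  \<open>M p - M (p - 1)\<close>, and the sum of these differences telescopes.\<close>

lemma b2_Suc:
  "b2 (Suc n) + card {S \<in> distinct_sets n. 1 \<notin> S} = b2 n + distinct_count n"
proof -
  let ?N = "\<lambda>p. card {S \<in> distinct_sets n. p \<in> S \<and> p - 1 \<notin> S}"
  let ?M = "\<lambda>p. card {S \<in> distinct_sets n. p \<notin> S}"
  have fin: "finite {S \<in> distinct_sets n. P S}" for P using finite_distinct_sets by simp
  have step: "card {S \<in> distinct_sets (Suc n). p \<in> S \<and> p - 1 \<notin> S} + ?M (p - 1) = ?N p + ?M p"
      if "2 \<le> p" for p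
  proof -
    have "?M p = card {S \<in> distinct_sets n. p \<notin> S \<and> p - 1 \<in> S} + card {S \<in> distinct_sets n. p \<notin> S
        \<and> p - 1 \<notin> S}"
      by (subst card_Un_disjoint[symmetric]) (auto intro!: fin arg_cong[where f = card])
    moreover have "?M (p - 1) = ?N p + card {S \<in> distinct_sets n. p \<notin> S \<and> p - 1 \<notin> S}"
      by (subst card_Un_disjoint[symmetric]) (auto intro!: fin arg_cong[where f = card])
    ultimately show ?thesis using card_replace_part[OF that, of n] by simp
  qed
  have "b2 (Suc n) + (\<Sum>p\<in>{2..Suc n}. ?M (p - 1)) = (\<Sum>p\<in>{2..Suc n}. ?N p) + (\<Sum>p\<in>{2..Suc n}. ?M p)"
    unfolding b2_eq_sum sum.distrib[symmetric] by (rule sum.cong) (use step in auto)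
  also have "(\<Sum>p\<in>{2..Suc n}. ?N p) = b2 n"
    unfolding b2_eq_sum by (rule sum.mono_neutral_right) (use part_le_size in \<open>fastforce simp:
        card_eq_0_iff\<close>)+
  also have "(\<Sum>p\<in>{2..Suc n}. ?M (p - 1)) = (\<Sum>p\<in>{1..n}. ?M p)"
    by (rule sum.reindex_bij_witness[where i = Suc and j = "\<lambda>p. p - 1"]) auto
  finally have "b2 (Suc n) + ((\<Sum>p\<in>{1..n}. ?M p) + ?M (Suc n))
      = b2 n + (\<Sum>p\<in>{2..Suc n}. ?M p) + ?M (Suc n)" by simp
  also have "(\<Sum>p\<in>{1..n}. ?M p) + ?M (Suc n) = (\<Sum>p\<in>{1..Suc n}. ?M p)" by simp
  also have "(\<Sum>p\<in>{1..Suc n}. ?M p) = ?M 1 + (\<Sum>p\<in>{2..Suc n}. ?M p)"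
    by (subst sum.atLeast_Suc_atMost) (simp_all add: numeral_2_eq_2)
  also have "?M (Suc n) = distinct_count n"
    unfolding distinct_count_def using part_le_size by (intro arg_cong[where f = card]) fastforce
  finally show ?thesis by simp
qed

text \<open>A part 1 can be removed from a partition of \<open>n + 1\<close> into distinct parts,
  leaving one of \<open>n\<close> without a part 1.\<close>

lemma distinct_count_Suc:
  "distinct_count (Suc n) = card {S \<in> distinct_sets n. 1 \<notin> S} + card {S \<in> distinct_sets (Suc n). 1 \<notin> S}"
proof -
  have "bij_betw (insert 1) {S \<in> distinct_sets n. 1 \<notin> S} {S \<in> distinct_sets (Suc n). 1 \<in> S}"
    by (rule bij_betw_byWitness[where f' = "\<lambda>S. S - {1}"])
       (auto simp: distinct_sets_def sum.insert_if sum.remove)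
  then have "card {S \<in> distinct_sets n. 1 \<notin> S} = card {S \<in> distinct_sets (Suc n). 1 \<in> S}"
    by (rule bij_betw_same_card)
  moreover have "distinct_count (Suc n) = card {S \<in> distinct_sets (Suc n). 1 \<in> S}
      + card {S \<in> distinct_sets (Suc n). 1 \<notin> S}"
    unfolding distinct_count_def
    by (subst card_Un_disjoint[symmetric]) (auto intro!: finite_distinct_sets arg_cong[where f = card])
  ultimately show ?thesis by simp
qed

text \<open>Applying the one-step recurrence twice, the partitions without a part 1 cancel.\<close>

lemma b2_Suc_Suc: "b2 (Suc (Suc n)) = b2 n + distinct_count n"
  using b2_Suc[of n] b2_Suc[of "Suc n"] distinct_count_Suc[of n] by linarith

text \<open>The recurrence with step 2, unfolded down to \<open>b2 0 = b2 1 = 0\<close>.\<close>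

lemma b2_eq_convolution:
  "b2 n = (\<Sum>k\<le>n. of_bool (even k \<and> 2 \<le> k) * distinct_count (n - k))"
proof (induction n rule: induct_nat_012)
  case 0
  show ?case by (simp add: b2_eq_sum)
next
  case 1
  show ?case by (simp add: b2_eq_sum)
next
  case (ge2 n)
  have "(\<Sum>k\<le>Suc (Suc n). of_bool (even k \<and> 2 \<le> k) * distinct_count (Suc (Suc n) - k))
      = (\<Sum>k\<le>n. of_bool (even k) * distinct_count (n - k))"
    by (simp add: sum.atMost_Suc_shift del: sum.atMost_Suc)
  also have "\<dots> = (\<Sum>k\<le>n. of_bool (k = 0) * distinct_count (n - k)) + (\<Sum>k\<le>n. of_bool (even k \<and> 2
      \<le> k) * distinct_count (n - k))"
    unfolding sum.distrib[symmetric]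
  proof (rule sum.cong[OF refl])
    fix k :: nat
    have "k = 0 \<or> k = 1 \<or> 2 \<le> k" by linarith
    then show "of_bool (even k) * distinct_count (n - k) = of_bool (k
        = 0) * distinct_count (n - k) + of_bool (even k \<and> 2 \<le> k) * distinct_count (n - k)"
      by auto
  qed
  also have "(\<Sum>k\<le>n. of_bool (k = 0) * distinct_count (n - k)) = distinct_count n"
    by (simp add: of_bool_def if_distrib[of "\<lambda>x. x * _"] sum.delta cong: if_cong)
  finally show ?case using b2_Suc_Suc[of n] ge2 by simp
qed

section \<open>Euler products and their logarithms\<close>

text \<open>Minus the logarithm of Euler's product \<open>\<Prod>k\<ge>1. 1 - q^k\<close>, as a Lambert
  series.\<close>

definition euler_log :: "complex \<Rightarrow> complex" where
  "euler_log q = (\<Sum>m. q ^ Suc m / (of_nat (Suc m) * (1 - q ^ Suc m)))"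

lemma one_minus_norm_le:
  fixes q :: complex
  assumes "norm (q::complex) < 1"
  shows "1 - norm q \<le> norm (1 - q ^ Suc m)"
proof -
  have "norm q ^ Suc m \<le> norm q"
    using assms power_decreasing[of 1 "Suc m" "norm q"] by simp
  moreover have "1 - norm (q ^ Suc m) \<le> norm (1 - q ^ Suc m)"
    using norm_triangle_ineq2[of 1 "q ^ Suc m"] by simp
  ultimately show ?thesis by (simp add: norm_power norm_mult)
qed

lemma one_minus_power_nonzero:
  fixes q :: complex
  assumes "norm (q::complex) < 1"
  shows "1 - q ^ Suc m \<noteq> 0"
  using one_minus_norm_le[OF assms, of m] assms by (metis diff_gt_0_iff_gt leD norm_zero)

lemma norm_euler_log_term_le:
  assumes "norm (q::complex) < 1"
  shows "norm (q ^ Suc m / (of_nat (Suc m) * (1 - q ^ Suc m))) \<le> norm q ^ Suc m / (1 - norm q)"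
proof -
  have "1 - norm q \<le> of_nat (Suc m) * norm (1 - q ^ Suc m)"
    using one_minus_norm_le[OF assms, of m] mult_right_mono[of 1 "of_nat (Suc m)" "norm (1
        - q ^ Suc m)"]
    by simp
  moreover have "norm (q ^ Suc m / (of_nat (Suc m) * (1 - q ^ Suc m)))
      = norm q ^ Suc m / (of_nat (Suc m) * norm (1 - q ^ Suc m))"
    by (simp only: norm_divide norm_mult norm_power norm_of_nat)
  ultimately show ?thesis
    using assms frac_le[of "norm q ^ Suc m" "norm q ^ Suc m" "1 - norm q"] by simp
qed

lemma summable_norm_power_bound:
  assumes "norm (q::complex) < 1"
  shows "summable (\<lambda>m. norm q ^ Suc m / (1 - norm q))"
  using summable_mult[OF summable_geometric, of "norm q" "norm q"] assms
  by (intro summable_divide) simp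

lemma summable_norm_euler_log:
  assumes "norm (q::complex) < 1"
  shows "summable (\<lambda>m. norm (q ^ Suc m / (of_nat (Suc m) * (1 - q ^ Suc m))))"
  by (rule summable_comparison_test'[OF summable_norm_power_bound[OF assms], of 0])
     (use norm_euler_log_term_le[OF assms] in simp)

lemma euler_log_sums:
  assumes "norm (q::complex) < 1"
  shows "(\<lambda>m. q ^ Suc m / (of_nat (Suc m) * (1 - q ^ Suc m))) sums euler_log q"
  using summable_norm_cancel[OF summable_norm_euler_log[OF assms]]
  unfolding euler_log_def by (rule summable_sums)

lemma Ln_one_minus_sums:
  assumes "norm (q::complex) < 1"
  shows "(\<lambda>m. - (q ^ Suc m / of_nat (Suc m))) sums Ln (1 - q)"
proof -
  have "(\<lambda>n. (-1) ^ Suc n / of_nat n * (- q) ^ n) sums Ln (1 + - q)"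
    by (rule Ln_series) (use assms in simp)
  moreover have "(-1) ^ Suc n / of_nat n * (- q) ^ n = - (q ^ n / of_nat n)" for n
  proof -
    have "(-1) ^ Suc n * (- q) ^ n = - (((-1) * (- q)) ^ n)"
      by (subst power_mult_distrib) simp
    then show ?thesis by (simp add: divide_inverse mult_ac)
  qed
  ultimately have "(\<lambda>n. - (q ^ n / of_nat n)) sums Ln (1 + - q)" by (simp only:)
  then have "(\<lambda>n. - (q ^ n / of_nat n)) sums Ln (1 - q)" by simp
  then show ?thesis by (subst sums_Suc_iff) simp
qed

text \<open>Expanding the finitely many logarithms and summing over \<open>k\<close> first gives a
  geometric sum, so that no interchange of two infinite summations is needed on the way to the Lambert
  series.\<close>

lemma sum_Ln_one_minus_powers:
  assumes q: "norm (q::complex) < 1"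
  shows "(\<lambda>m. - (q ^ Suc m * (1 - q ^ (Suc m * N)) / (of_nat (Suc m) * (1 - q ^ Suc m))))
           sums (\<Sum>k=1..N. Ln (1 - q ^ k))"
proof -
  have "(\<lambda>m. \<Sum>k=1..N. - ((q ^ k) ^ Suc m / of_nat (Suc m))) sums (\<Sum>k=1..N. Ln (1 - q ^ k))"
  proof (intro sums_sum Ln_one_minus_sums)
    fix k assume "k \<in> {1..N}"
    then show "norm (q ^ k) < 1" using q by (simp add: norm_power power_less_one_iff)
  qed
  moreover have "(\<Sum>k=1..N. - ((q ^ k) ^ Suc m / of_nat (Suc m))) =
      - (q ^ Suc m * (1 - q ^ (Suc m * N)) / (of_nat (Suc m) * (1 - q ^ Suc m)))" for m
  proof -
    define x where "x = q ^ Suc m"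
    have x: "1 - x \<noteq> 0" unfolding x_def by (rule one_minus_power_nonzero[OF q])
    have "(q ^ k) ^ Suc m = x ^ k" for k
      unfolding x_def by (simp only: power_mult[symmetric] mult.commute)
    then have "(\<Sum>k=1..N. - ((q ^ k) ^ Suc m / of_nat (Suc m))) = - ((\<Sum>k=1..N. x ^ k) / of_nat (Suc m))"
      by (simp only: sum_negf sum_divide_distrib)
    also have "(\<Sum>k=1..N. x ^ k) = x * (1 - x ^ N) / (1 - x)"
    proof -
      have "(1 - x) * (\<Sum>k=1..N. x ^ k) = x * (1 - x ^ N)"
      proof (induction N)
        case (Suc N)
        have "(1 - x) * (\<Sum>k=1..Suc N. x ^ k) = (1 - x) * (\<Sum>k=1..N. x ^ k) + (1 - x) * x ^ Suc N"
          by (simp add: distrib_left)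
        also have "\<dots> = x * (1 - x ^ Suc N)"
          unfolding Suc by (simp add: algebra_simps)
        finally show ?case .
      qed simp
      then show ?thesis using x by (metis nonzero_mult_div_cancel_left)
    qed
    finally have "(\<Sum>k=1..N. - ((q ^ k) ^ Suc m / of_nat (Suc m)))
        = - (x * (1 - x ^ N) / (of_nat (Suc m) * (1 - x)))"
      by (simp add: mult.commute)
    moreover have "x ^ N = q ^ (Suc m * N)"
      unfolding x_def by (simp only: power_mult)
    ultimately show ?thesis by (simp only: x_def)
  qed
  ultimately show ?thesis by (simp only:)
qed

text \<open>The partial sums of the logarithms differ from the full series by terms that carry a factor
  \<open>q ^ (m * N)\<close>, whose modulus is at most \<open>norm q ^ N\<close>.\<close>

lemma euler_product_tendsto:
  assumes q: "norm (q::complex) < 1"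
  shows "(\<lambda>N. \<Prod>k=1..N. 1 - q ^ k) \<longlonglongrightarrow> exp (- euler_log q)"
proof -
  let ?x = "\<lambda>m. q ^ Suc m / (of_nat (Suc m) * (1 - q ^ Suc m))"
  have step: "- (- (a * (1 - b) / e)) - a / e = - (b * (a / e))" for a b e :: complex
    by (simp add: right_diff_distrib diff_divide_distrib mult.commute)
  have bound: "norm (- (\<Sum>k=1..N. Ln (1 - q ^ k)) - euler_log q)
        \<le> norm q ^ N * (\<Sum>m. norm (?x m))" for N
  proof -
    have "(\<lambda>m. - (- (q ^ Suc m * (1 - q ^ (Suc m * N)) / (of_nat (Suc m) * (1 - q ^ Suc m)))) - ?x m)
            sums (- (\<Sum>k=1..N. Ln (1 - q ^ k)) - euler_log q)"
      by (intro sums_diff sums_minus sum_Ln_one_minus_powers euler_log_sums q)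
    moreover have "- (- (q ^ Suc m * (1 - q ^ (Suc m * N)) / (of_nat (Suc m) * (1 - q ^ Suc m)))) - ?x m
        = - (q ^ (Suc m * N) * ?x m)" for m
      by (rule step)
    ultimately have s: "(\<lambda>m. - (q ^ (Suc m * N) * ?x m))
        sums (- (\<Sum>k=1..N. Ln (1 - q ^ k)) - euler_log q)"
      by (simp only:)
    have le: "norm (- (q ^ (Suc m * N) * ?x m)) \<le> norm q ^ N * norm (?x m)" for m
    proof -
      have "norm q ^ (Suc m * N) \<le> norm q ^ N"
        by (rule power_decreasing) (use q in auto)
      then have "norm q ^ (Suc m * N) * norm (?x m) \<le> norm q ^ N * norm (?x m)"
        by (rule mult_right_mono) simp
      then show ?thesis by (simp only: norm_minus_cancel norm_mult norm_power)
    qed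
    have sm: "summable (\<lambda>m. norm q ^ N * norm (?x m))"
      by (intro summable_mult summable_norm_euler_log q)
    then have sm': "summable (\<lambda>m. norm (- (q ^ (Suc m * N) * ?x m)))"
      by (rule summable_comparison_test') (use le in simp)
    have "norm (- (\<Sum>k=1..N. Ln (1 - q ^ k)) - euler_log q) \<le> (\<Sum>m. norm (- (q ^ (Suc m * N) * ?x m)))"
      using summable_norm[OF sm'] sums_unique[OF s] by simp
    also have "\<dots> \<le> (\<Sum>m. norm q ^ N * norm (?x m))"
      by (rule suminf_le[OF le sm' sm])
    also have "\<dots> = norm q ^ N * (\<Sum>m. norm (?x m))"
      by (rule suminf_mult) (rule summable_norm_euler_log[OF q])
    finally show ?thesis .
  qed
  have "(\<lambda>N. norm q ^ N * (\<Sum>m. norm (?x m))) \<longlonglongrightarrow> 0"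
    using q by (intro tendsto_mult_left_zero LIMSEQ_power_zero) auto
  then have "(\<lambda>N. - (\<Sum>k=1..N. Ln (1 - q ^ k)) - euler_log q) \<longlonglongrightarrow> 0"
    by (rule Lim_null_comparison[rotated]) (use bound in auto)
  then have "(\<lambda>N. exp (- (- (\<Sum>k=1..N. Ln (1 - q ^ k)))))  \<longlonglongrightarrow> exp (- euler_log q)"
    by (intro tendsto_exp tendsto_minus) (rule LIM_zero_cancel)
  moreover have "exp (- (- (\<Sum>k=1..N. Ln (1 - q ^ k)))) = (\<Prod>k=1..N. 1 - q ^ k)" for N
  proof -
    have "1 - q ^ k \<noteq> 0" if "k \<in> {1..N}" for k
      using one_minus_power_nonzero[OF q, of "k - 1"] that by (cases k) auto
    then show ?thesis by (simp add: exp_sum)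
  qed
  ultimately show ?thesis by simp
qed

text \<open>The logarithm of \<open>\<Prod>k\<ge>1. 1 + q^k\<close>, because
  \<open>1 + x = (1 - x\<^sup>2) / (1 - x)\<close>.\<close>

definition partition_log :: "complex \<Rightarrow> complex" where
  "partition_log q = euler_log q - euler_log (q\<^sup>2)"

lemma norm_power2_less_1: "norm (q::complex) < 1 \<Longrightarrow> norm (q\<^sup>2) < 1"
  by (simp add: norm_power power_less_one_iff)

lemma distinct_product_tendsto:
  assumes q: "norm (q::complex) < 1"
  shows "(\<lambda>N. \<Prod>k=1..N. 1 + q ^ k) \<longlonglongrightarrow> exp (partition_log q)"
proof -
  have "(\<lambda>N. (\<Prod>k=1..N. 1 - (q\<^sup>2) ^ k) / (\<Prod>k=1..N. 1 - q ^ k))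
     \<longlonglongrightarrow> exp (- euler_log (q\<^sup>2)) / exp (- euler_log q)"
    by (intro tendsto_divide euler_product_tendsto q norm_power2_less_1) simp
  moreover have "(\<Prod>k=1..N. 1 - (q\<^sup>2) ^ k) / (\<Prod>k=1..N. 1 - q ^ k) = (\<Prod>k=1..N. 1 + q ^ k)" for N
  proof -
    have nz: "1 - q ^ k \<noteq> 0" if "k \<in> {1..N}" for k
      using one_minus_power_nonzero[OF q, of "k - 1"] that by (cases k) auto
    show ?thesis
      unfolding prod_dividef[symmetric]
    proof (intro prod.cong refl)
      fix k assume "k \<in> {1..N}"
      moreover have "1 - (q\<^sup>2) ^ k = (1 + q ^ k) * (1 - q ^ k)"
        by (simp add: algebra_simps power2_eq_square power_mult_distrib)
      ultimately show "(1 - (q\<^sup>2) ^ k) / (1 - q ^ k) = 1 + q ^ k"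
        using nz by simp
    qed
  qed
  ultimately show ?thesis by (simp add: partition_log_def exp_diff exp_minus field_simps)
qed

text \<open>Cancelling the even factors of Euler's product leaves the odd ones; with the previous limit
  this is Euler's theorem on odd and distinct parts.\<close>

lemma odd_product_tendsto:
  assumes q: "norm (q::complex) < 1"
  shows "(\<lambda>N. \<Prod>k=1..N. inverse (1 - q ^ (2 * k - 1))) \<longlonglongrightarrow> exp (partition_log q)"
proof -
  have "(\<lambda>N. (\<Prod>k=1..N. 1 - (q\<^sup>2) ^ k) / (\<Prod>k=1..2*N. 1 - q ^ k))
     \<longlonglongrightarrow> exp (- euler_log (q\<^sup>2)) / exp (- euler_log q)"
    by (intro tendsto_divide euler_product_tendsto q norm_power2_less_1
          filterlim_compose[OF euler_product_tendsto[OF q] mult_nat_left_at_top]) auto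
  moreover have "(\<Prod>k=1..N. 1 - (q\<^sup>2) ^ k) / (\<Prod>k=1..2*N. 1 - q ^ k)
      = (\<Prod>k=1..N. inverse (1 - q ^ (2 * k - 1)))" for N
  proof -
    have nz: "1 - q ^ Suc k \<noteq> 0" for k
      using one_minus_power_nonzero[OF q, of k] .
    show ?thesis
    proof (induction N)
      case (Suc N)
      have "(q\<^sup>2) ^ Suc N = q ^ Suc (Suc (2 * N))" by (simp add: power_mult power2_eq_square)
      then have "(\<Prod>k=1..Suc N. 1 - (q\<^sup>2) ^ k) / (\<Prod>k=1..2 * Suc N. 1 - q ^ k)
          = (\<Prod>k=1..N. 1 - (q\<^sup>2) ^ k) / (\<Prod>k=1..2 * N. 1 - q ^ k) * inverse (1 - q ^ Suc (2 * N))"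
        using nz[of "Suc (2 * N)"] by (simp add: divide_inverse del: power_Suc)
      also have "\<dots> = (\<Prod>k=1..Suc N. inverse (1 - q ^ (2 * k - 1)))"
        unfolding Suc by simp
      finally show ?case .
    qed simp
  qed
  ultimately show ?thesis by (simp add: partition_log_def exp_diff exp_minus field_simps)
qed

section \<open>Generating functions of odd and of distinct partitions\<close>

lemma sums_shift_power:
  fixes f :: "nat \<Rightarrow> nat" and q :: complex
  assumes "(\<lambda>n. of_nat (f n) * q ^ n) sums s"
  shows "(\<lambda>n. of_nat (if k \<le> n then f (n - k) else 0) * q ^ n) sums (q ^ k * s)"
proof -
  let ?g = "\<lambda>n. of_nat (if k \<le> n then f (n - k) else 0) * q ^ n"
  have "(\<lambda>n. q ^ k * (of_nat (f n) * q ^ n)) sums (q ^ k * s)"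
    using assms by (rule sums_mult)
  also have "(\<lambda>n. q ^ k * (of_nat (f n) * q ^ n)) = (\<lambda>n. ?g (n + k))"
    by (simp add: power_add mult_ac)
  finally have "(\<lambda>n. ?g (n + k)) sums (q ^ k * s)" .
  moreover have "?g n = 0" if "n < k" for n using that by simp
  ultimately show ?thesis using sums_zero_iff_shift[of k ?g] by blast
qed

text \<open>In the applications \<open>c N n\<close> counts the partitions of \<open>n\<close>
  whose parts are bounded in terms of \<open>N\<close>. Their generating functions are finite products.
  At the point \<open>norm q\<close> these products bound the partial sums of the full series, which
  gives absolute convergence; Tannery's theorem then passes to the limit.\<close>

lemma generating_function_limit:
  fixes c :: "nat \<Rightarrow> nat \<Rightarrow> nat" and P :: "nat \<Rightarrow> complex \<Rightarrow> complex"
  assumes le: "\<And>N n. c N n \<le> d n" and eq: "\<And>N n. n \<le> N \<Longrightarrow> c N n = d n"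
    and sums: "\<And>N q. norm q < 1 \<Longrightarrow> (\<lambda>n. of_nat (c N n) * q ^ n) sums P N q"
    and lim: "\<And>q. norm q < 1 \<Longrightarrow> (\<lambda>N. P N q) \<longlonglongrightarrow> L q"
    and q: "norm q < 1"
  shows "(\<lambda>n. of_nat (d n) * q ^ n) sums L q"
proof -
  define r where "r = norm q"
  have r: "0 \<le> r" "norm (complex_of_real r) < 1" using q by (simp_all add: r_def)
  have cr: "(\<lambda>n. real (c N n) * r ^ n) sums Re (P N (of_real r))" for N
    using sums_Re[OF sums[OF r(2), of N]] by (simp flip: of_real_power)
  have "Bseq (\<lambda>N. P N (of_real r))" using lim[OF r(2)] by (intro convergent_imp_Bseq convergentI)
  then obtain K where K: "\<And>N. norm (P N (of_real r)) \<le> K" unfolding Bseq_def by auto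
  have sd: "summable (\<lambda>n. real (d n) * r ^ n)"
  proof (rule summableI_nonneg_bounded[where x = K])
    fix m
    have "(\<Sum>n<m. real (d n) * r ^ n) = (\<Sum>n<m. real (c m n) * r ^ n)"
      using eq by (intro sum.cong) auto
    also have "\<dots> \<le> (\<Sum>n. real (c m n) * r ^ n)"
      using cr[of m] r(1) by (intro sum_le_suminf) (auto simp: sums_iff)
    also have "\<dots> = Re (P m (of_real r))" using cr[of m] by (simp add: sums_iff)
    also have "\<dots> \<le> K" using K[of m] complex_Re_le_cmod order_trans by blast
    finally show "(\<Sum>n<m. real (d n) * r ^ n) \<le> K" .
  qed (use r in simp)
  have "(\<lambda>N. \<Sum>n. of_nat (c N n) * q ^ n) \<longlonglongrightarrow> (\<Sum>n. of_nat (d n) * q ^ n)"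
  proof (rule tannerys_theorem[THEN conjunct2, THEN conjunct2])
    fix n
    have "\<forall>\<^sub>F N in sequentially. of_nat (d n) * q ^ n = of_nat (c N n) * q ^ n"
      using eventually_ge_at_top[of n] by eventually_elim (simp add: eq)
    then show "(\<lambda>N. of_nat (c N n) * q ^ n) \<longlonglongrightarrow> of_nat (d n) * q ^ n"
      by (rule Lim_transform_eventually[OF tendsto_const])
  next
    have "norm (of_nat (c N n) * q ^ n) \<le> real (d n) * r ^ n" for N n
      using le[of N n] by (simp add: norm_mult norm_power r_def mult_right_mono)
    then show "\<forall>\<^sub>F (n, N) in sequentially \<times>\<^sub>F sequentially. norm (of_nat (c N n) * q ^ n)
        \<le> real (d n) * r ^ n"
      by (intro always_eventually) auto
  qed (use sd in auto)
  moreover have "(\<Sum>n. of_nat (c N n) * q ^ n) = P N q" for N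
    using sums[OF q] by (simp add: sums_iff)
  ultimately have "(\<Sum>n. of_nat (d n) * q ^ n) = L q"
    using lim[OF q] by (metis (no_types, lifting) LIMSEQ_unique ext)
  moreover have "summable (\<lambda>n. of_nat (d n) * q ^ n)"
    by (rule summable_norm_cancel) (use sd in \<open>simp add: norm_mult norm_power r_def\<close>)
  ultimately show ?thesis by (simp add: sums_iff)
qed

text \<open>Allowing one further part \<open>N + 1\<close> multiplies the generating function by
  \<open>1 + q ^ (N + 1)\<close>.\<close>

lemma distinct_count_sums:
  assumes q: "norm (q::complex) < 1"
  shows "(\<lambda>n. of_nat (distinct_count n) * q ^ n) sums exp (partition_log q)"
proof -
  define c where "c = (\<lambda>N n. card {S \<in> distinct_sets n. S \<subseteq> {1..N}})"
  have fin: "finite {S \<in> distinct_sets n. P S}" for P n using finite_distinct_sets by simp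
  have rec: "c (Suc N) n = c N n + (if Suc N \<le> n then c N (n - Suc N) else 0)" for N n
  proof -
    have "{S \<in> distinct_sets n. S \<subseteq> {1..Suc N}} = {S \<in> distinct_sets n. S \<subseteq> {1..N}} \<union>
        {S \<in> distinct_sets n. S \<subseteq> {1..Suc N} \<and> Suc N \<in> S}"
      by (auto simp: atLeastAtMostSuc_conv) 
    then have "c (Suc N) n = c N n + card {S \<in> distinct_sets n. S \<subseteq> {1..Suc N} \<and> Suc N \<in> S}"
      unfolding c_def by (simp only:, intro card_Un_disjoint fin) auto
    also have "card {S \<in> distinct_sets n. S \<subseteq> {1..Suc N} \<and> Suc N \<in> S} = (if Suc N
        \<le> n then c N (n - Suc N) else 0)"
    proof (cases "Suc N \<le> n")
      case True
      have "bij_betw (insert (Suc N)) {S \<in> distinct_sets (n - Suc N). S \<subseteq> {1..N}}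
              {S \<in> distinct_sets n. S \<subseteq> {1..Suc N} \<and> Suc N \<in> S}"
      proof (rule bij_betw_byWitness[where f' = "\<lambda>S. S - {Suc N}"])
        show "insert (Suc N) ` {S \<in> distinct_sets (n - Suc N). S \<subseteq> {1..N}}
            \<subseteq> {S \<in> distinct_sets n. S \<subseteq> {1..Suc N} \<and> Suc N \<in> S}"
        proof (intro image_subsetI CollectI conjI)
          fix S assume S: "S \<in> {S \<in> distinct_sets (n - Suc N). S \<subseteq> {1..N}}"
          then have "Suc N \<notin> S" by auto
          then show "insert (Suc N) S \<in> distinct_sets n" using S True by (auto simp: distinct_sets_def)
          show "insert (Suc N) S \<subseteq> {1..Suc N}" using S by auto
        qed simp
        show "(\<lambda>S. S - {Suc N}) ` {S \<in> distinct_sets n. S \<subseteq> {1..Suc N} \<and> Suc N \<in> S}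
            \<subseteq> {S \<in> distinct_sets (n - Suc N). S \<subseteq> {1..N}}"
        proof (intro image_subsetI CollectI conjI)
          fix S assume S: "S \<in> {S \<in> distinct_sets n. S \<subseteq> {1..Suc N} \<and> Suc N \<in> S}"
          then have "\<Sum>S = Suc N + \<Sum>(S - {Suc N})" by (intro sum.remove) (auto simp: distinct_sets_def)
          then show "S - {Suc N} \<in> distinct_sets (n - Suc N)" using S by (auto simp: distinct_sets_def)
          show "S - {Suc N} \<subseteq> {1..N}" using S by (auto simp: le_Suc_eq subset_iff)
        qed
      qed (auto simp: subset_iff)
      from bij_betw_same_card[OF this] show ?thesis using True by (simp add: c_def)
    next
      case False
      then have "{S \<in> distinct_sets n. S \<subseteq> {1..Suc N} \<and> Suc N \<in> S} = {}"
        using part_le_size by blast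
      then show ?thesis using False by (simp only: card.empty if_False)
    qed
    finally show ?thesis .
  qed
  have sums: "(\<lambda>n. of_nat (c N n) * q ^ n) sums (\<Prod>k=1..N. 1 + q ^ k)" if "norm q < 1" for N
      and q :: complex
  proof (induction N)
    case 0
    have "c 0 n = (if n = 0 then 1 else 0)" for n
    proof -
      have "{S \<in> distinct_sets n. S \<subseteq> {1..0}} = (if n = 0 then {{}} else {})"
        by (auto simp: distinct_sets_def)
      then show ?thesis by (simp add: c_def)
    qed
    then have "(\<lambda>n. of_nat (c 0 n) * q ^ n) = (\<lambda>n. if n = 0 then 1 else 0)" by auto
    then show ?case using sums_single[of 0 "\<lambda>_. 1::complex"] by simp
  next
    case (Suc N)
    have "(\<lambda>n. of_nat (c N n) * q ^ n + of_nat (if Suc N \<le> n then c N (n - Suc N) else 0) * q ^ n)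
      sums ((\<Prod>k=1..N. 1 + q ^ k) + q ^ Suc N * (\<Prod>k=1..N. 1 + q ^ k))"
      by (intro sums_add sums_shift_power Suc)
    moreover have "(\<Prod>k=1..N. 1 + q ^ k) + q ^ Suc N * (\<Prod>k=1..N. 1 + q ^ k) = (\<Prod>k=1..Suc N. 1 + q ^ k)"
      by (simp add: algebra_simps)
    ultimately show ?case unfolding rec of_nat_add distrib_right by simp
  qed
  show ?thesis
  proof (rule generating_function_limit[where c = c and P = "\<lambda>N q. \<Prod>k=1..N. 1 + q ^ k"])
    show "c N n \<le> distinct_count n" for N n
      unfolding c_def distinct_count_def by (intro card_mono finite_distinct_sets) auto
    show "c N n = distinct_count n" if "n \<le> N" for N n
    proof -
      have "S \<subseteq> {1..N}" if "S \<in> distinct_sets n" for S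
      proof
        fix p assume "p \<in> S"
        then show "p \<in> {1..N}"
          using part_le_size[OF that] \<open>n \<le> N\<close> that by (cases "p
              = 0") (auto simp: distinct_sets_def intro: order_trans)
      qed
      then have "{S \<in> distinct_sets n. S \<subseteq> {1..N}} = distinct_sets n" by auto
      then show ?thesis by (simp only: c_def distinct_count_def)
    qed
  qed (use sums distinct_product_tendsto q in auto)
qed

text \<open>Allowing one further part size \<open>p\<close> with arbitrary multiplicity leads to a
  recurrence in which the new count occurs on both sides; solved for the new generating function, it
  gives the factor \<open>1 / (1 - q ^ p)\<close>. The solution presupposes convergence, which is
  shown first.\<close>

lemma odd_count_sums:
  assumes q: "norm (q::complex) < 1"
  shows "(\<lambda>n. of_nat (odd_count n) * q ^ n) sums exp (partition_log q)"
proof -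
  define c where "c = (\<lambda>N n. card {M \<in> odd_multisets n. set_mset M \<subseteq> {..<2 * N}})"
  have fin: "finite {M \<in> odd_multisets n. P M}" for P n using finite_odd_multisets by simp
  have rec: "c (Suc N) n = c N n + (if 2 * N + 1 \<le> n then c (Suc N) (n - (2 * N + 1)) else 0)" for N n
  proof -
    let ?p = "2 * N + 1"
    have "{M \<in> odd_multisets n. set_mset M \<subseteq> {..<2 * Suc N}} = {M \<in> odd_multisets n. set_mset M
        \<subseteq> {..<2 * N}} \<union>
        {M \<in> odd_multisets n. set_mset M \<subseteq> {..<2 * Suc N} \<and> ?p \<in># M}"
    proof (intro set_eqI iffI)
      fix M assume M: "M \<in> {M \<in> odd_multisets n. set_mset M \<subseteq> {..<2 * Suc N}}"
      have "p < 2 * N" if "p \<in># M" "?p \<notin># M" for p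
      proof -
        have "p < 2 * Suc N" "odd p" using M that by (auto simp: odd_multisets_def)
        moreover have "p \<noteq> ?p" using that by auto
        moreover have "p \<noteq> 2 * N" using \<open>odd p\<close> by auto
        ultimately show ?thesis by simp
      qed
      then show "M \<in> {M \<in> odd_multisets n. set_mset M \<subseteq> {..<2 * N}} \<union>
        {M \<in> odd_multisets n. set_mset M \<subseteq> {..<2 * Suc N} \<and> ?p \<in># M}" using M by auto
    qed auto
    then have "c (Suc N) n = c N n + card {M \<in> odd_multisets n. set_mset M \<subseteq> {..<2 * Suc N} \<and> ?p \<in># M}"
      unfolding c_def by (simp only:, intro card_Un_disjoint fin) auto
    also have "card {M \<in> odd_multisets n. set_mset M \<subseteq> {..<2 * Suc N} \<and> ?p \<in># M} = (if ?p
        \<le> n then c (Suc N) (n - ?p) else 0)"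
    proof (cases "?p \<le> n")
      case True
      have "bij_betw (add_mset ?p) {M \<in> odd_multisets (n - ?p). set_mset M \<subseteq> {..<2 * Suc N}}
              {M \<in> odd_multisets n. set_mset M \<subseteq> {..<2 * Suc N} \<and> ?p \<in># M}"
      proof (rule bij_betw_byWitness[where f' = "\<lambda>M. M - {#?p#}"])
        show "add_mset ?p ` {M \<in> odd_multisets (n - ?p). set_mset M \<subseteq> {..<2 * Suc N}}
            \<subseteq> {M \<in> odd_multisets n. set_mset M \<subseteq> {..<2 * Suc N} \<and> ?p \<in># M}"
          using True by (intro image_subsetI) (simp add: odd_multisets_def)
        show "(\<lambda>M. M - {#?p#}) ` {M \<in> odd_multisets n. set_mset M \<subseteq> {..<2 * Suc N} \<and> ?p \<in># M}
            \<subseteq> {M \<in> odd_multisets (n - ?p). set_mset M \<subseteq> {..<2 * Suc N}}"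
        proof (intro image_subsetI)
          fix M assume "M \<in> {M \<in> odd_multisets n. set_mset M \<subseteq> {..<2 * Suc N} \<and> ?p \<in># M}"
          then obtain M' where "M = add_mset ?p M'" "M \<in> odd_multisets n" "set_mset M \<subseteq> {..<2 * Suc N}"
            by (auto dest: multi_member_split)
          then show "M - {#?p#} \<in> {M \<in> odd_multisets (n - ?p). set_mset M \<subseteq> {..<2 * Suc N}}"
            by (auto simp: odd_multisets_def)
        qed
      qed auto
      from bij_betw_same_card[OF this] show ?thesis using True by (simp add: c_def)
    next
      case False
      have "{M \<in> odd_multisets n. set_mset M \<subseteq> {..<2 * Suc N} \<and> ?p \<in># M} = {}"
        using False by (auto simp: odd_multisets_def dest!: multi_member_split)
      then show ?thesis using False by (simp only: card.empty if_False)
    qed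
    finally show ?thesis .
  qed
  have sums: "(\<lambda>n. of_nat (c N n) * q ^ n) sums (\<Prod>k=1..N. inverse (1 - q ^ (2 * k - 1)))"
      if q: "norm q < 1" for N and q :: complex
    using q
  proof (induction N arbitrary: q)
    case 0
    have "c 0 n = (if n = 0 then 1 else 0)" for n
    proof -
      have "{M \<in> odd_multisets n. set_mset M \<subseteq> {..<2 * 0}} = (if n = 0 then {{#}} else {})"
        by (auto simp: odd_multisets_def)
      then show ?thesis by (simp add: c_def)
    qed
    then have "(\<lambda>n. of_nat (c 0 n) * q ^ n) = (\<lambda>n. if n = 0 then 1 else 0)" by auto
    then show ?case using sums_single[of 0 "\<lambda>_. 1::complex"] by simp
  next
    case (Suc N)
    let ?p = "2 * N + 1"
    let ?P = "\<lambda>N q. \<Prod>k=1..N. inverse (1 - q ^ (2 * k - 1))"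
    define r where "r = norm q"
    have r: "0 \<le> r" "r < 1" "norm (complex_of_real r) < 1" using Suc.prems by (simp_all add: r_def)
    have rp: "r ^ ?p < 1" using power_decreasing[of 1 ?p r] r by simp
    have cr: "(\<lambda>n. real (c N n) * r ^ n) sums Re (?P N (of_real r))"
      using sums_Re[OF Suc.IH[OF r(3)]] by (simp flip: of_real_power)
    have rec_real: "real (c (Suc N) n) * r ^ n
        = real (c N n) * r ^ n + real (if ?p \<le> n then c (Suc N) (n - ?p) else 0) * r ^ n" for n
      by (subst rec) (simp only: of_nat_add distrib_right)
    have sm: "summable (\<lambda>n. real (c (Suc N) n) * r ^ n)"
    proof (rule summableI_nonneg_bounded[where x = "Re (?P N (of_real r)) / (1 - r ^ ?p)"])
      fix m
      let ?S = "\<lambda>m. \<Sum>n<m. real (c (Suc N) n) * r ^ n"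
      \<comment> \<open>The recurrence bounds a partial sum of the new series by one of \<open>c
        N\<close> plus \<open>r ^ ?p\<close> times itself, which proves convergence before the value
        of the sum is known.\<close>
      have shift: "(\<Sum>n<m + ?p. real (if ?p \<le> n then c (Suc N) (n - ?p) else 0) * r ^ n)
          = r ^ ?p * ?S m" for m
      proof (induction m)
        case (Suc m)
        have "(\<Sum>n<Suc m + ?p. real (if ?p \<le> n then c (Suc N) (n - ?p) else 0) * r ^ n)
            = r ^ ?p * ?S m + real (c (Suc N) m) * r ^ (m + ?p)"
          unfolding Suc.IH[symmetric] by simp
        then show ?case by (simp add: power_add algebra_simps)
      qed simp
      have "?S m \<le> ?S (m + ?p)" using r by (intro sum_mono2) auto
      also have "\<dots> = (\<Sum>n<m + ?p. real (c N n) * r ^ n) + (\<Sum>n<m + ?p. real (if ?p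
          \<le> n then c (Suc N) (n - ?p) else 0) * r ^ n)"
        unfolding sum.distrib[symmetric] by (rule sum.cong[OF refl], rule rec_real)
      also have "\<dots> \<le> Re (?P N (of_real r)) + r ^ ?p * ?S m"
      proof -
        have "(\<Sum>n<m + ?p. real (c N n) * r ^ n) \<le> (\<Sum>n. real (c N n) * r ^ n)"
          by (rule sum_le_suminf) (use cr r(1) in \<open>auto simp: sums_iff\<close>)
        then show ?thesis unfolding shift sums_unique[OF cr, symmetric] by simp
      qed
      finally have "?S m * (1 - r ^ ?p) \<le> Re (?P N (of_real r))" by (simp add: algebra_simps)
      then show "?S m \<le> Re (?P N (of_real r)) / (1 - r ^ ?p)" using rp
          by (simp only: pos_le_divide_eq diff_gt_0_iff_gt)
    qed (use r in simp)
    have "summable (\<lambda>n. of_nat (c (Suc N) n) * q ^ n)"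
      by (rule summable_norm_cancel) (use sm in \<open>simp add: norm_mult norm_power r_def\<close>)
    then obtain s where s: "(\<lambda>n. of_nat (c (Suc N) n) * q ^ n) sums s" by (auto simp: summable_def)
    have "(\<lambda>n. of_nat (c N n) * q ^ n + of_nat (if ?p \<le> n then c (Suc N) (n - ?p) else 0) * q ^ n)
      sums (?P N q + q ^ ?p * s)"
      by (intro sums_add sums_shift_power Suc.IH Suc.prems s)
    moreover have "(\<lambda>n. of_nat (c (Suc N) n) * q ^ n)
        = (\<lambda>n. of_nat (c N n) * q ^ n + of_nat (if ?p \<le> n then c (Suc N) (n - ?p) else 0) * q ^ n)"
      by (rule ext, subst rec) (simp only: of_nat_add distrib_right)
    ultimately have "(\<lambda>n. of_nat (c (Suc N) n) * q ^ n) sums (?P N q + q ^ ?p * s)"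
      by metis
    with s have "s = ?P N q + q ^ ?p * s" by (rule sums_unique2)
    then have "s * (1 - q ^ ?p) = ?P N q" by (simp add: algebra_simps)
    moreover have "1 - q ^ ?p \<noteq> 0" using one_minus_power_nonzero[OF Suc.prems, of "2 * N"] by simp
    ultimately have "s = ?P N q * inverse (1 - q ^ ?p)" by (simp add: field_simps)
    also have "\<dots> = ?P (Suc N) q" by simp
    finally show ?case using s by simp
  qed
  show ?thesis
  proof (rule generating_function_limit[where c = c and P
      = "\<lambda>N q. \<Prod>k=1..N. inverse (1 - q ^ (2 * k - 1))"])
    show "c N n \<le> odd_count n" for N n
      unfolding c_def odd_count_def by (intro card_mono finite_odd_multisets) auto
    show "c N n = odd_count n" if "n \<le> N" for N n
    proof -
      have "p < 2 * N" if "M \<in> odd_multisets n" "p \<in># M" for M p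
      proof -
        have "p \<le> n" using that by (auto simp: odd_multisets_def dest!: multi_member_split)
        moreover have "p \<noteq> 0" using that by (auto simp: odd_multisets_def intro!: Nat.gr0I)
        ultimately show ?thesis using \<open>n \<le> N\<close> by simp
      qed
      then have "{M \<in> odd_multisets n. set_mset M \<subseteq> {..<2 * N}} = odd_multisets n" by auto
      then show ?thesis by (simp only: c_def odd_count_def)
    qed
  qed (use sums odd_product_tendsto q in auto)
qed

section \<open>Size of the generating function on a circle\<close>

text \<open>From \<open>x / (1 - x) - x\<^sup>2 / (1 - x\<^sup>2) = x / (1 - x\<^sup>2)\<close>. In this
  form every term is a power series in \<open>q\<close> with nonnegative coefficients, which is what the
  comparison of moduli on a circle rests on.\<close>

lemma partition_log_sums:
  assumes q: "norm (q::complex) < 1"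
  shows "(\<lambda>m. q ^ Suc m / (of_nat (Suc m) * (1 - (q ^ Suc m)\<^sup>2))) sums partition_log q"
proof -
  have "(\<lambda>m. q ^ Suc m / (of_nat (Suc m) * (1 - q ^ Suc m))
           - (q\<^sup>2) ^ Suc m / (of_nat (Suc m) * (1 - (q\<^sup>2) ^ Suc m))) sums partition_log q"
    unfolding partition_log_def by (intro sums_diff euler_log_sums q norm_power2_less_1)
  moreover have "q ^ Suc m / (of_nat (Suc m) * (1 - q ^ Suc m))
           - (q\<^sup>2) ^ Suc m / (of_nat (Suc m) * (1 - (q\<^sup>2) ^ Suc m))
        = q ^ Suc m / (of_nat (Suc m) * (1 - (q ^ Suc m)\<^sup>2))" for m
  proof -
    have *: "x / (c * (1 - x)) - x\<^sup>2 / (c * (1 - x\<^sup>2)) = x / (c * (1 - x\<^sup>2))"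
      if "1 - x \<noteq> 0" "1 - x\<^sup>2 \<noteq> 0" for x c :: complex
    proof -
      have f: "1 - x\<^sup>2 = (1 - x) * (1 + x)" by (simp add: algebra_simps power2_eq_square)
      then have "1 + x \<noteq> 0" using that by auto
      then have "x / (c * (1 - x)) = x * (1 + x) / (c * (1 - x) * (1 + x))" by simp
      also have "\<dots> = (x + x\<^sup>2) / (c * (1 - x\<^sup>2))"
        by (simp only: f mult.assoc) (simp add: distrib_left power2_eq_square)
      finally show ?thesis by (simp only: diff_divide_distrib[symmetric] add_diff_cancel)
    qed
    have "(q\<^sup>2) ^ Suc m = (q ^ Suc m)\<^sup>2" by (simp only: power_mult[symmetric] mult.commute)
    moreover from this have "1 - (q ^ Suc m)\<^sup>2 \<noteq> 0"
      using one_minus_power_nonzero[OF norm_power2_less_1[OF q], of m] by (simp only: not_False_eq_True)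
    ultimately show ?thesis
      using *[OF one_minus_power_nonzero[OF q]] by (simp only:)
  qed
  ultimately show ?thesis by (simp only:)
qed

text \<open>The series at \<open>q\<^sup>2\<close> consists of the terms with an even exponent,
  doubled, so the difference is an alternating sum. Grouping consecutive terms makes the cancellation
  explicit; near \<open>q = 1\<close> it removes the logarithmic terms that the two series have
  separately.\<close>

lemma partition_log_paired_sums:
  assumes q: "norm (q::complex) < 1"
  defines "x \<equiv> \<lambda>m. q ^ Suc m / (of_nat (Suc m) * (1 - q ^ Suc m))"
  shows "(\<lambda>j. x (2 * j) - x (2 * j + 1)) sums partition_log q"
proof -
  have "(\<lambda>j. sum x {j * 2..<j * 2 + 2}) sums euler_log q"
    using euler_log_sums[OF q] unfolding x_def by (rule sums_group) simp
  moreover have "sum x {j * 2..<j * 2 + 2} = x (2 * j) + x (2 * j + 1)" for j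
    by (simp add: mult.commute)
  ultimately have "(\<lambda>j. x (2 * j) + x (2 * j + 1)) sums euler_log q" by simp
  moreover have "(\<lambda>j. 2 * x (2 * j + 1)) sums euler_log (q\<^sup>2)"
  proof -
    have "(q\<^sup>2) ^ Suc j / (of_nat (Suc j) * (1 - (q\<^sup>2) ^ Suc j)) = 2 * x (2 * j + 1)" for j
    proof -
      have "(q\<^sup>2) ^ Suc j = q ^ Suc (2 * j + 1)" 
      proof -
        have "Suc (2 * j + 1) = 2 * Suc j" by simp
        then show ?thesis by (simp only: power_mult)
      qed
      moreover have "of_nat (Suc (2 * j + 1)) = 2 * (of_nat (Suc j) :: complex)" by simp
      moreover have *: "u / (c * v) = 2 * (u / (2 * c * v))" for u c v :: complex by simp
      ultimately show ?thesis unfolding x_def by (metis *)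
    qed
    then show ?thesis using euler_log_sums[OF norm_power2_less_1[OF q]] by (simp only:)
  qed
  ultimately have "(\<lambda>j. x (2 * j) + x (2 * j + 1) - 2 * x (2 * j + 1)) sums partition_log q"
    unfolding partition_log_def by (rule sums_diff)
  then show ?thesis by simp
qed

text \<open>The real part of a term at \<open>q\<close> is at most the value of that term at
  \<open>norm q\<close>; the bound keeps the loss in the first term only.\<close>

lemma norm_exp_partition_log_le:
  fixes q :: complex and r :: real
  assumes r: "0 < r" "r < 1" and q: "norm q = r"
  shows "norm (exp (partition_log q))
     \<le> exp (Re (partition_log (of_real r)) - (r / (1 - r\<^sup>2) - Re (q / (1 - q\<^sup>2))))"
proof -
  let ?y = "\<lambda>q m. Re (q ^ Suc m / (of_nat (Suc m) * (1 - (q ^ Suc m)\<^sup>2)))"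
  have yr: "?y (of_real r) m = r ^ Suc m / (of_nat (Suc m) * (1 - (r ^ Suc m)\<^sup>2))" for m
  proof -
    have "of_real r ^ Suc m / (of_nat (Suc m) * (1 - (of_real r ^ Suc m)\<^sup>2))
        = complex_of_real (r ^ Suc m / (of_nat (Suc m) * (1 - (r ^ Suc m)\<^sup>2)))"
      by simp
    then show ?thesis by (simp only: Re_complex_of_real)
  qed
  have "(\<lambda>m. ?y (of_real r) m - ?y q m) sums (Re (partition_log (of_real r)) - Re (partition_log q))"
    using r q by (intro sums_diff sums_Re partition_log_sums) auto
  moreover have "0 \<le> ?y (of_real r) m - ?y q m" for m
  proof -
    define x where "x = r ^ Suc m"
    have x: "0 < x" "x < 1" using r by (simp_all add: x_def power_less_one_iff del: power_Suc)
    then have x2: "x\<^sup>2 < 1" by (simp add: power_less_one_iff)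
    have nx: "norm (q ^ Suc m) = x" by (simp only: norm_power q x_def)
    have "1 - x\<^sup>2 \<le> norm (1 - (q ^ Suc m)\<^sup>2)"
      using norm_triangle_ineq2[of 1 "(q ^ Suc m)\<^sup>2"]
          by (simp only: norm_power[of "q ^ Suc m"] nx norm_one)
    then have "x / (of_nat (Suc m) * norm (1 - (q ^ Suc m)\<^sup>2)) \<le> x / (of_nat (Suc m) * (1 - x\<^sup>2))"
      using x x2 by (intro frac_le mult_left_mono mult_pos_pos) auto
    moreover have "?y q m \<le> x / (of_nat (Suc m) * norm (1 - (q ^ Suc m)\<^sup>2))"
      using complex_Re_le_cmod[of "q ^ Suc m / (of_nat (Suc m) * (1 - (q ^ Suc m)\<^sup>2))"]
      by (simp only: norm_divide norm_mult nx norm_of_nat)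
    ultimately show ?thesis unfolding yr x_def by linarith
  qed
  ultimately have "?y (of_real r) 0 - ?y q 0 \<le> Re (partition_log (of_real r)) - Re (partition_log q)"
    by (metis (no_types, lifting) sum_le_suminf[of _ "{0}"] finite.emptyI finite.insertI
        sums_summable sums_unique
        sum.empty sum.insert empty_iff add_0_right)
  then have "Re (partition_log q) \<le> Re (partition_log (of_real r)) - (r / (1 - r\<^sup>2) - Re (q / (1
      - q\<^sup>2)))"
    unfolding yr by simp
  then show ?thesis by (simp add: norm_exp)
qed

text \<open>With \<open>q = exp (- z)\<close> one has
  \<open>q / (1 - q\<^sup>2) = 1 / (2 * sinh z)\<close>, so the loss is an explicit function
  of \<open>S = 2 * sinh t\<close> and \<open>x = 1 - cos \<theta>\<close>. The lower bound is
  increasing in \<open>x\<close> and decreasing in \<open>S\<close>, so simpler estimates of these two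
  quantities can be substituted later; it also covers the neighbourhood of
  \<open>\<theta> = \<pi>\<close>, where \<open>sin \<theta>\<close> is small but the real part is
  negative.\<close>

lemma Re_deficit_ge:
  fixes t \<theta> :: real
  assumes t: "0 < t"
  defines "q \<equiv> of_real (exp (- t)) * cis \<theta>" and "S \<equiv> exp t - exp (- t)" and "x \<equiv> 1 - cos \<theta>"
  shows "4 * x / (S * (S\<^sup>2 + 4 * x))
     \<le> exp (- t) / (1 - (exp (- t))\<^sup>2) - Re (q / (1 - q\<^sup>2))"
proof -
  define y where "y = 2 - x"
  define C where "C = exp t + exp (- t)"
  have S: "0 < S" using t by (simp add: S_def)
  have CS: "C\<^sup>2 = S\<^sup>2 + 4"
    by (simp add: C_def S_def power2_eq_square algebra_simps mult_exp_exp)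
  have xy: "0 \<le> x" "0 \<le> y" using cos_le_one[of \<theta>] cos_ge_minus_one[of \<theta>]
    unfolding x_def y_def by linarith+
  have sin: "(sin \<theta>)\<^sup>2 = x * y"
    by (simp add: x_def y_def sin_squared_eq power2_eq_square algebra_simps)
  have q0: "q \<noteq> 0" by (simp add: q_def)
  have "q / (1 - q\<^sup>2) = 1 / (1 / q - q)"
    using q0 by (simp add: divide_simps power2_eq_square)
  also have "1 / q = of_real (exp t) * cis (- \<theta>)"
  proof -
    have "of_real (exp t) * cis (- \<theta>) * q = of_real (exp t * exp (- t)) * (cis (- \<theta>) * cis \<theta>)"
      by (simp only: q_def of_real_mult mult_ac)
    also have "\<dots> = 1" by (simp add: cis_mult mult_exp_exp del: of_real_mult)
    finally show ?thesis using q0 by (simp add: field_simps)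
  qed
  also have "of_real (exp t) * cis (- \<theta>) - q = Complex (S * cos \<theta>) (- (C * sin \<theta>))"
    by (simp add: q_def S_def C_def complex_eq_iff algebra_simps)
  also have "Re (1 / Complex (S * cos \<theta>) (- (C * sin \<theta>)))
      = S * cos \<theta> / ((S * cos \<theta>)\<^sup>2 + (C * sin \<theta>)\<^sup>2)"
    by (simp add: Re_divide)
  also have "(S * cos \<theta>)\<^sup>2 + (C * sin \<theta>)\<^sup>2 = S\<^sup>2 + 4 * (x * y)"
    using sin by (simp add: power_mult_distrib CS cos_squared_eq algebra_simps)
  finally have Re: "Re (q / (1 - q\<^sup>2)) = S * (1 - x) / (S\<^sup>2 + 4 * (x * y))"
    by (simp add: x_def)
  have r: "exp (- t) / (1 - (exp (- t))\<^sup>2) = 1 / S"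
  proof -
    have "S * exp (- t) = 1 - (exp (- t))\<^sup>2"
      by (simp add: S_def algebra_simps power2_eq_square mult_exp_exp)
    then have "exp (- t) / (1 - (exp (- t))\<^sup>2) = exp (- t) / (S * exp (- t))" by simp
    then show ?thesis by simp
  qed
  have d: "0 < S\<^sup>2 + 4 * (x * y)" "0 < S\<^sup>2 + 4 * x"
    using S xy by (auto intro!: add_pos_nonneg)
  have "1 / S - S * (1 - x) / (S\<^sup>2 + 4 * (x * y)) = x * (S\<^sup>2 + 4 * y) / (S * (S\<^sup>2 + 4 * (x * y)))"
    using S d by (simp add: divide_simps) (simp add: y_def algebra_simps power2_eq_square)
  also have "\<dots> \<ge> 4 * x / (S * (S\<^sup>2 + 4 * x))"
  proof -
    have "4 * (S\<^sup>2 + 4 * (x * y)) \<le> (S\<^sup>2 + 4 * y) * (S\<^sup>2 + 4 * x)"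
    proof -
      have "(S\<^sup>2 + 4 * y) * (S\<^sup>2 + 4 * x) = S\<^sup>2 * S\<^sup>2 + 8 * S\<^sup>2 + 16 * (x * y)"
        by (simp add: y_def algebra_simps)
      then show ?thesis by simp
    qed
    then have "4 / (S\<^sup>2 + 4 * x) \<le> (S\<^sup>2 + 4 * y) / (S\<^sup>2 + 4 * (x * y))"
      using d by (simp add: divide_simps)
    then have "x / S * (4 / (S\<^sup>2 + 4 * x)) \<le> x / S * ((S\<^sup>2 + 4 * y) / (S\<^sup>2 + 4 * (x * y)))"
      using S xy by (intro mult_left_mono) auto
    then show ?thesis by (simp add: mult_ac)
  qed
  finally show ?thesis unfolding Re r .
qed

section \<open>Behaviour of the generating function near one\<close>

text \<open>The remainder in \<open>w / (exp w - 1) = 1 - w / 2 + w\<^sup>2 * \<phi> w\<close>, the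
  expansion that generates the Bernoulli numbers.\<close>

definition bernoulli_remainder :: "complex \<Rightarrow> complex" where
  "bernoulli_remainder w = (1 / (exp w - 1) - 1 / w + 1 / 2) / w"

lemma exp_neq_1_near_0:
  assumes "norm w < 6" "w \<noteq> 0"
  shows "exp w \<noteq> (1::complex)"
proof
  assume "exp w = 1"
  then obtain n :: int where n: "Re w = 0" "Im w = of_int (2 * n) * pi"
    by (auto simp: exp_eq_1)
  have "n \<noteq> 0" using n assms by (auto simp: complex_eq_iff)
  then have "1 \<le> \<bar>real_of_int n\<bar>" by linarith
  then have "2 * 3 \<le> 2 * \<bar>real_of_int n\<bar> * pi"
    using pi_gt3 by (intro mult_mono) auto
  also have "\<dots> = \<bar>Im w\<bar>" using n by (simp add: abs_mult)
  also have "\<dots> \<le> norm w" by (rule abs_Im_le_cmod)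
  finally show False using assms by simp
qed

text \<open>Dividing \<open>exp w - 1\<close> by \<open>w\<close>, inverting, and twice subtracting
  the value at 0 and dividing by \<open>w\<close>, all singularities at 0 are removable. The value
  \<open>-1/2\<close> of the first derivative follows from the symmetry
  \<open>H (- w) = H w + w\<close> of \<open>H w = w / (exp w - 1)\<close>.\<close>

lemma bernoulli_remainder_extends_holomorphically:
  obtains g where "g holomorphic_on ball 0 6" "\<And>w. w \<noteq> 0 \<Longrightarrow> w \<in> ball 0 6 \<Longrightarrow> g w = bernoulli_remainder w"
proof -
  define E where "E = (\<lambda>w. if w = 0 then deriv exp 0 else (exp w - exp 0) / (w - (0::complex)))"
  have holE: "E holomorphic_on ball 0 6"
    unfolding E_def by (rule pole_lemma_open) (auto intro!: holomorphic_intros)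
  have E0: "E 0 = 1" by (simp add: E_def DERIV_imp_deriv[OF DERIV_exp])
  have E: "E w = (exp w - 1) / w" if "w \<noteq> 0" for w using that by (simp add: E_def)
  have Enz: "E w \<noteq> 0" if "w \<in> ball 0 6" for w
    using that exp_neq_1_near_0[of w] by (cases "w = 0") (auto simp: E0 E)
  define H where "H = (\<lambda>w. 1 / E w)"
  have holH: "H holomorphic_on ball 0 6"
    unfolding H_def by (intro holomorphic_intros holE) (use Enz in auto)
  have H0: "H 0 = 1" by (simp add: H_def E0)
  have H: "H w = w / (exp w - 1)" if "w \<noteq> 0" for w using that by (simp add: H_def E)
  have refl: "H (- w) = H w + w" if "w \<in> ball 0 6" for w
  proof (cases "w = 0")
    case False
    have "exp w - 1 \<noteq> 0" using exp_neq_1_near_0[of w] that False by auto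
    then show ?thesis using False
      by (simp add: H exp_minus divide_simps) (simp add: algebra_simps)
  qed (simp add: H0)
  have dH: "(H has_field_derivative deriv H 0) (at 0)"
    by (rule holomorphic_derivI[OF holH]) auto
  have "((\<lambda>w. H (- w)) has_field_derivative - deriv H 0) (at 0)"
    by (rule DERIV_chain2[where g = uminus, THEN DERIV_cong]) (auto intro!: derivative_eq_intros dH)
  moreover have "((\<lambda>w. H (- w)) has_field_derivative deriv H 0 + 1) (at 0)"
  proof (rule has_field_derivative_transform_within_open[where S = "ball 0 6"])
    show "((\<lambda>w. H w + w) has_field_derivative deriv H 0 + 1) (at 0)"
      by (intro DERIV_add dH DERIV_ident)
  qed (use refl in auto)
  ultimately have "- deriv H 0 = deriv H 0 + 1" by (rule DERIV_unique)
  then have dH0: "deriv H 0 = - 1 / 2" by (auto simp: complex_eq_iff)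
  define H1 where "H1 = (\<lambda>w. if w = 0 then deriv H 0 else (H w - H 0) / (w - 0))"
  have holH1: "H1 holomorphic_on ball 0 6"
    unfolding H1_def by (rule pole_lemma_open[OF holH]) auto
  have H10: "H1 0 = - 1 / 2" by (simp add: H1_def dH0)
  have H1: "H1 w = 1 / (exp w - 1) - 1 / w" if "w \<noteq> 0" for w
    using that by (simp add: H1_def H0 H diff_divide_distrib)
  define H2 where "H2 = (\<lambda>w. if w = 0 then deriv H1 0 else (H1 w - H1 0) / (w - 0))"
  have "H2 holomorphic_on ball 0 6"
    unfolding H2_def by (rule pole_lemma_open[OF holH1]) auto
  moreover have "H2 w = bernoulli_remainder w" if "w \<noteq> 0" for w
    using that by (simp add: H2_def H10 H1 bernoulli_remainder_def)
  ultimately show ?thesis using that by blast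
qed

lemma bernoulli_remainder_has_derivative:
  assumes "Re w > 0"
  shows "(bernoulli_remainder has_field_derivative
     - ((1 / (exp w - 1) - 1 / w + 1 / 2) / w\<^sup>2) + (1 / w\<^sup>2 - exp w / (exp w - 1)\<^sup>2) / w) (at w)"
proof -
  have "w \<noteq> 0" using assms by auto
  moreover have "exp w - 1 \<noteq> 0"
    using assms by (auto simp: exp_eq_1)
  ultimately show ?thesis
    unfolding bernoulli_remainder_def
    by (auto intro!: derivative_eq_intros simp: power2_eq_square) (simp add: diff_divide_distrib)
qed

lemma norm_le_2_Re:
  assumes "\<bar>Im w\<bar> \<le> Re w"
  shows "norm w \<le> 2 * Re w"
  using cmod_le[of w] assms by linarith

text \<open>In the sector, \<open>norm w\<close> is at most \<open>2 * Re w\<close>, so the terms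
  with exponentials are controlled by \<open>exp x - 1 \<ge> x\<close> and
  \<open>exp x - 1 \<ge> x * exp (x / 2)\<close> for \<open>x = Re w\<close>.\<close>

lemma norm_deriv_bernoulli_remainder_le_large:
  assumes w: "\<bar>Im w\<bar> \<le> Re w" "1 \<le> norm w"
  shows "norm (deriv bernoulli_remainder w) \<le> 9 / norm w ^ 2"
proof -
  define x where "x = Re w"
  define y where "y = norm w"
  have y: "1 \<le> y" "y \<le> 2 * x" using w norm_le_2_Re[OF w(1)] by (simp_all add: x_def y_def)
  then have x: "0 < x" by simp
  have e: "exp x - 1 \<le> norm (exp w - 1)"
    using norm_triangle_ineq2[of "exp w" 1] by (simp add: x_def)
  have ex: "x \<le> exp x - 1" using exp_ge_add_one_self[of x] by linarith
  have "norm (1 / (exp w - 1)) = 1 / norm (exp w - 1)" by (simp add: norm_divide)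
  also have "\<dots> \<le> 1 / (1 / 2)" using e ex y by (intro frac_le) auto
  finally have b1: "norm (1 / (exp w - 1)) \<le> 2" by simp
  have "x * exp (x / 2) \<le> exp x - 1"
  proof -
    have "x / 2 \<le> sinh (x / 2)" using real_le_x_sinh[of "x / 2"] x by (simp add: sinh_def exp_minus)
    then have "x * exp (x / 2) \<le> 2 * sinh (x / 2) * exp (x / 2)" by simp
    also have "\<dots> = exp x - 1" by (simp add: sinh_def algebra_simps mult_exp_exp)
    finally show ?thesis .
  qed
  then have "(x * exp (x / 2))\<^sup>2 \<le> (norm (exp w - 1))\<^sup>2"
    using e x by (intro power_mono) auto
  then have s: "x\<^sup>2 * exp x \<le> (norm (exp w - 1))\<^sup>2"
    by (simp add: power_mult_distrib exp_double[symmetric])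
  have "norm (exp w / (exp w - 1)\<^sup>2) = exp x / (norm (exp w - 1))\<^sup>2"
    by (simp add: norm_divide norm_power x_def)
  also have "\<dots> \<le> exp x / (x\<^sup>2 * exp x)" using s x by (intro frac_le) auto
  also have "\<dots> = 1 / x\<^sup>2" by simp
  also have "\<dots> \<le> 1 / (y / 2)\<^sup>2" using y by (intro frac_le power_mono) auto
  also have "\<dots> = 4 / y\<^sup>2" by (simp add: power_divide)
  finally have b2: "norm (exp w / (exp w - 1)\<^sup>2) \<le> 4 / y\<^sup>2" .
  have b3: "norm (1 / w) \<le> 1" using w by (simp add: norm_divide divide_le_eq)
  have b4: "norm (1 / w\<^sup>2) = 1 / y\<^sup>2" by (simp add: norm_divide norm_power y_def)
  have d: "deriv bernoulli_remainder w = - ((1 / (exp w - 1) - 1 / w + 1 / 2) / w\<^sup>2) + (1 / w\<^sup>2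
      - exp w / (exp w - 1)\<^sup>2) / w"
    by (rule DERIV_imp_deriv[OF bernoulli_remainder_has_derivative]) (use x in \<open>simp add: x_def\<close>)
  have "norm (1 / (exp w - 1) - 1 / w + 1 / 2) \<le> 4"
  proof -
    have "norm (1 / (exp w - 1) - 1 / w + 1 / 2)
        \<le> norm (1 / (exp w - 1)) + norm (1 / w) + norm (1 / 2 :: complex)"
      by (intro norm_triangle_le add_mono norm_triangle_ineq4) simp
    then show ?thesis using b1 b3 by simp
  qed
  then have "norm ((1 / (exp w - 1) - 1 / w + 1 / 2) / w\<^sup>2) \<le> 4 / y\<^sup>2"
    unfolding norm_divide norm_power y_def by (intro divide_right_mono) auto
  moreover have "norm ((1 / w\<^sup>2 - exp w / (exp w - 1)\<^sup>2) / w) \<le> 5 / y\<^sup>2"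
  proof -
    have "norm (1 / w\<^sup>2 - exp w / (exp w - 1)\<^sup>2) \<le> 1 / y\<^sup>2 + 4 / y\<^sup>2"
      using b2 b4 by (intro norm_triangle_le_diff) simp
    then have "norm ((1 / w\<^sup>2 - exp w / (exp w - 1)\<^sup>2) / w) \<le> (5 / y\<^sup>2) / y"
      unfolding norm_divide[of _ w] y_def[symmetric] using y by (intro divide_right_mono) auto
    also have "\<dots> \<le> (5 / y\<^sup>2) / 1" using y by (intro frac_le) auto
    finally show ?thesis by simp
  qed
  ultimately show ?thesis unfolding d y_def[symmetric]
    by (intro norm_triangle_le) simp
qed

text \<open>The derivative is bounded near 0 and decays like \<open>norm w powr (- 2)\<close> at
  infinity; an exponent strictly between 1 and 2 serves both ranges. That it exceeds 1 makes the sum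
  over the multiples of \<open>z\<close> converge, that it is below 2 makes the total error vanish with
  \<open>z\<close>.\<close>

lemma bernoulli_remainder_deriv_bound:
  obtains K where "0 < K" "\<And>w. w \<noteq> 0 \<Longrightarrow> \<bar>Im w\<bar> \<le> Re w \<Longrightarrow> norm (deriv bernoulli_remainder w)
      \<le> K * norm w powr (- 3 / 2)"
proof -
  obtain g where g: "g holomorphic_on ball 0 6" "\<And>w. w \<noteq> 0 \<Longrightarrow> w \<in> ball 0 6 \<Longrightarrow> g w = bernoulli_remainder w"
    using bernoulli_remainder_extends_holomorphically by blast
  have "continuous_on (cball 0 1) (deriv g)"
    by (rule continuous_on_subset[OF holomorphic_on_imp_continuous_on[OF holomorphic_deriv[OF
        g(1)]]]) auto
  then have "bounded (deriv g ` cball 0 1)"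
    by (intro compact_imp_bounded compact_continuous_image) auto
  then obtain B where B: "\<And>w. w \<in> cball 0 1 \<Longrightarrow> norm (deriv g w) \<le> B"
    unfolding bounded_iff by (meson imageI)
  define K where "K = max B 9"
  have "norm (deriv bernoulli_remainder w) \<le> K * norm w powr (- 3 / 2)" if w: "w \<noteq> 0" "\<bar>Im w\<bar>
      \<le> Re w" for w
  proof (cases "norm w \<le> 1")
    case True
    have "(g has_field_derivative deriv g w) (at w)"
      by (rule holomorphic_derivI[OF g(1)]) (use True in auto)
    then have "(bernoulli_remainder has_field_derivative deriv g w) (at w)"
      by (rule has_field_derivative_transform_within_open[where S = "ball 0 6 - {0}"])
         (use True w g(2) in auto)
    then have "norm (deriv bernoulli_remainder w) \<le> B" using B[of w] True by (simp add: DERIV_imp_deriv)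
    also have "\<dots> \<le> K * 1" by (simp add: K_def)
    also have "\<dots> \<le> K * norm w powr (- 3 / 2)"
    proof (rule mult_left_mono)
      have "norm w powr 0 \<le> norm w powr (- 3 / 2)"
        using True w by (intro powr_mono') auto
      then show "1 \<le> norm w powr (- 3 / 2)" using w by simp
    qed (simp add: K_def)
    finally show ?thesis .
  next
    case False
    then have "norm (deriv bernoulli_remainder w) \<le> 9 / norm w ^ 2"
        using norm_deriv_bernoulli_remainder_le_large[OF w(2)] by simp
    also have "\<dots> = 9 * norm w powr (- 2)" using w by (simp add: powr_minus powr_numeral divide_inverse)
    also have "\<dots> \<le> K * norm w powr (- 3 / 2)"
      using False by (intro mult_mono powr_mono) (auto simp: K_def)
    finally show ?thesis .
  qed
  moreover have "0 < K" by (simp add: K_def)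
  ultimately show ?thesis using that by blast
qed

text \<open>The mean value inequality on the segment between two neighbouring multiples of
  \<open>z\<close>. The segment stays in the sector, and its point closest to 0 is the left end.\<close>

lemma bernoulli_remainder_difference_le:
  assumes K: "0 < K" "\<And>w. w \<noteq> 0 \<Longrightarrow> \<bar>Im w\<bar> \<le> Re w \<Longrightarrow> norm (deriv bernoulli_remainder w)
      \<le> K * norm w powr (- 3 / 2)"
    and z: "0 < Re z" "\<bar>Im z\<bar> \<le> Re z" and s: "1 \<le> s"
  shows "norm (bernoulli_remainder (of_real s * z) - bernoulli_remainder (of_real (s + 1) * z))
      \<le> K * (s * norm z) powr (- 3 / 2) * norm z"
proof -
  let ?S = "closed_segment (of_real s * z) (of_real (s + 1) * z)"
  have "norm (bernoulli_remainder (of_real s * z) - bernoulli_remainder (of_real (s + 1) * z))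
      \<le> (K * (s * norm z) powr (- 3 / 2)) * norm (of_real s * z - of_real (s + 1) * z)"
  proof (rule field_differentiable_bound[of ?S bernoulli_remainder "deriv bernoulli_remainder"])
    fix w assume "w \<in> ?S"
    then obtain u where u: "0 \<le> u" "u \<le> 1"
        "w = of_real (1 - u) * (of_real s * z) + of_real u * (of_real (s + 1) * z)"
      by (auto simp: in_segment scaleR_conv_of_real)
    then have w: "w = of_real (s + u) * z" by (simp add: algebra_simps)
    have Rw: "0 < Re w" using w z s u by simp
    have Iw: "\<bar>Im w\<bar> \<le> Re w" using w z s u by (simp add: abs_mult mult_left_mono)
    have "(bernoulli_remainder has_field_derivative deriv bernoulli_remainder w) (at w)"
      using bernoulli_remainder_has_derivative[OF Rw] by (simp add: DERIV_imp_deriv)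
    then show "(bernoulli_remainder has_field_derivative deriv bernoulli_remainder w) (at w within ?S)"
      by (rule has_field_derivative_at_within)
    have "norm w powr (- 3 / 2) \<le> (s * norm z) powr (- 3 / 2)"
    proof (rule powr_mono2')
      show "0 < s * norm z" using s z by (auto intro!: mult_pos_pos)
      show "s * norm z \<le> norm w" using w s u by (simp add: norm_mult mult_right_mono del: of_real_add)
    qed simp
    then show "norm (deriv bernoulli_remainder w) \<le> K * (s * norm z) powr (- 3 / 2)"
      using K(2)[OF _ Iw] Rw K(1) by (smt (verit, best) mult_left_mono zero_complex.simps(1))
  qed auto
  also have "of_real s * z - of_real (s + 1) * z = - z" by (simp add: algebra_simps)
  finally show ?thesis by simp
qed

text \<open>The even squares account for a quarter of \<open>\<pi>\<^sup>2 / 6\<close> and are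
  subtracted twice.\<close>

lemma alternating_inverse_squares_sums:
  "(\<lambda>j. 1 / (real (2 * j + 1))\<^sup>2 - 1 / (real (2 * j + 2))\<^sup>2) sums (pi\<^sup>2 / 12)"
proof -
  let ?f = "\<lambda>n. 1 / (real (n + 1))\<^sup>2"
  have "(\<lambda>j. sum ?f {j * 2..<j * 2 + 2}) sums (pi\<^sup>2 / 6)"
    using inverse_squares_sums by (intro sums_group) auto
  moreover have "sum ?f {j * 2..<j * 2 + 2} = 1 / (real (2 * j + 1))\<^sup>2 + 1 / (real (2 * j + 2))\<^sup>2" for j
    by (simp add: mult.commute add.commute)
  ultimately have "(\<lambda>j. 1 / (real (2 * j + 1))\<^sup>2 + 1 / (real (2 * j + 2))\<^sup>2) sums (pi\<^sup>2 / 6)"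
    by (simp only:)
  moreover have "(\<lambda>j. 2 * (1 / (real (2 * j + 2))\<^sup>2)) sums (pi\<^sup>2 / 12)"
  proof -
    have "2 * (1 / (real (2 * j + 2))\<^sup>2) = 1 / 2 * ?f j" for j
    proof -
      have "real (2 * j + 2) = 2 * real (j + 1)" by simp
      then have "real (2 * j + 2) ^ 2 = 4 * real (j + 1) ^ 2" by (simp only: power_mult_distrib) simp
      then show ?thesis by simp
    qed
    moreover have "(\<lambda>j. 1 / 2 * ?f j) sums (1 / 2 * (pi\<^sup>2 / 6))"
      using inverse_squares_sums by (intro sums_mult) auto
    ultimately show ?thesis by simp
  qed
  ultimately have "(\<lambda>j. 1 / (real (2 * j + 1))\<^sup>2 + 1 / (real (2 * j + 2))\<^sup>2 - 2 * (1 / (real (2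
      * j + 2))\<^sup>2))
     sums (pi\<^sup>2 / 6 - pi\<^sup>2 / 12)" by (rule sums_diff)
  then show ?thesis by simp
qed

text \<open>The \<open>m\<close>-th term of the Lambert series at \<open>exp (- z)\<close> is
  \<open>1 / (m * (exp (m * z) - 1)) = 1 / (m\<^sup>2 * z) - 1 / (2 * m) + z * \<phi> (m * z)\<close>.
  In the alternating sum the first two parts give \<open>\<pi>\<^sup>2 / (12 * z)\<close> and
  \<open>- ln 2 / 2\<close>. The third is a sum of differences of \<open>\<phi>\<close> at
  neighbouring multiples of \<open>z\<close>, and the derivative bound makes it
  \<open>O(sqrt (norm z))\<close>.\<close>

lemma partition_log_asymptotics:
  obtains K where "0 < K" and
    "\<And>z. 0 < Re z \<Longrightarrow> \<bar>Im z\<bar> \<le> Re z \<Longrightarrow>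
       norm (partition_log (exp (- z)) - (of_real (pi\<^sup>2 / 12) / z - of_real (ln 2 / 2)))
           \<le> K * sqrt (norm z)"
proof -
  obtain K where K: "0 < K"
    "\<And>w. w \<noteq> 0 \<Longrightarrow> \<bar>Im w\<bar> \<le> Re w \<Longrightarrow> norm (deriv bernoulli_remainder w) \<le> K * norm w powr (- 3 / 2)"
    using bernoulli_remainder_deriv_bound by blast
  let ?p = "\<lambda>j. real (2 * j + 1) powr (- 3 / 2)"
  have sp: "summable ?p"
  proof (rule summable_comparison_test'[of "\<lambda>j. real (Suc j) powr (- 3 / 2)" 0])
    show "summable (\<lambda>j. real (Suc j) powr (- 3 / 2))"
      by (subst summable_Suc_iff) (simp add: summable_real_powr_iff)
    show "norm (?p j) \<le> real (Suc j) powr (- 3 / 2)" for j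
      by (simp add: powr_mono2')
  qed
  define B where "B = (\<Sum>j. ?p j)"
  have B: "0 < B" unfolding B_def by (rule suminf_pos[OF sp]) auto
  have main: "norm (partition_log (exp (- z)) - (of_real (pi\<^sup>2 / 12) / z - of_real (ln 2 / 2)))
      \<le> K * B * sqrt (norm z)"
    if z: "0 < Re z" "\<bar>Im z\<bar> \<le> Re z" for z
  proof -
    define q where "q = exp (- z)"
    have q: "norm q < 1" using z by (simp add: q_def)
    have z0: "z \<noteq> 0" "0 < norm z" using z by auto
    define x where "x = (\<lambda>m. q ^ Suc m / (of_nat (Suc m) * (1 - q ^ Suc m)))"
    have x: "x m = z * bernoulli_remainder (of_nat (Suc m) * z) + of_real (1 / (real (Suc m))\<^sup>2)
        / z - of_real (1 / real (Suc m)) / 2" for m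
    proof -
      define M :: complex where "M = of_nat (Suc m)"
      have M0: "M \<noteq> 0" unfolding M_def by (simp del: of_nat_Suc)
      have qM: "q ^ Suc m = 1 / exp (M * z)"
        by (simp add: q_def M_def exp_of_nat_mult[symmetric] exp_minus[symmetric] divide_inverse
            del: power_Suc of_nat_Suc)
      have e: "exp (M * z) \<noteq> 1"
        using one_minus_power_nonzero[OF q, of m] unfolding qM by auto
      have "x m = 1 / (M * (exp (M * z) - 1))"
        unfolding x_def qM M_def[symmetric] using e M0 by (simp add: divide_simps)
      moreover have "z * bernoulli_remainder (M * z)
          = 1 / (M * (exp (M * z) - 1)) - 1 / M\<^sup>2 / z + 1 / M / 2"
        unfolding bernoulli_remainder_def using e M0 z0(1) by (simp add: divide_simps power2_eq_square)
      ultimately show ?thesis by (simp add: M_def del: of_nat_Suc)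
    qed
    have s1: "(\<lambda>j. x (2 * j) - x (2 * j + 1)) sums partition_log q"
      using partition_log_paired_sums[OF q] by (simp only: x_def)
    have s2: "(\<lambda>j. of_real (1 / (real (2 * j + 1))\<^sup>2 - 1 / (real (2 * j + 2))\<^sup>2) / z)
        sums (of_real (pi\<^sup>2 / 12) / z)"
      by (intro sums_divide sums_of_real alternating_inverse_squares_sums)
    have "(\<lambda>j. 1 / real (2 * j + 1) - 1 / real (2 * j + 2)) sums ln 2"
      using alternating_harmonic_series_sums' by (simp only: inverse_eq_divide)
    then have s3: "(\<lambda>j. complex_of_real (1 / real (2 * j + 1) - 1 / real (2 * j + 2)) / 2)
        sums (of_real (ln 2) / 2)"
      by (intro sums_divide sums_of_real)
    let ?d = "\<lambda>j. z * (bernoulli_remainder (of_nat (2 * j + 1) * z)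
        - bernoulli_remainder (of_nat (2 * j + 2) * z))"
    have "(\<lambda>j. (x (2 * j) - x (2 * j + 1)) - (of_real (1 / (real (2 * j + 1))\<^sup>2 - 1 / (real (2 * j
        + 2))\<^sup>2) / z
           - complex_of_real (1 / real (2 * j + 1) - 1 / real (2 * j + 2)) / 2))
         sums (partition_log q - (of_real (pi\<^sup>2 / 12) / z - of_real (ln 2) / 2))"
      by (intro sums_diff s1 s2 s3)
    moreover have "(x (2 * j) - x (2 * j + 1)) - (of_real (1 / (real (2 * j + 1))\<^sup>2 - 1 / (real (2
        * j + 2))\<^sup>2) / z
           - complex_of_real (1 / real (2 * j + 1) - 1 / real (2 * j + 2)) / 2) = ?d j" for j
    proof -
      have *: "z * a + u / z - v / 2 - (z * b + u' / z - v' / 2) - ((u - u') / z - (v - v') / 2)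
          = z * (a - b)"
        for a b u u' v v' :: complex
        by (simp add: right_diff_distrib diff_divide_distrib)
      have S: "Suc (2 * j) = 2 * j + 1" "Suc (2 * j + 1) = 2 * j + 2" by auto
      show ?thesis unfolding x S of_real_diff by (rule *)
    qed
    ultimately have sd: "?d sums (partition_log q - (of_real (pi\<^sup>2 / 12) / z - of_real (ln 2) / 2))"
      by (simp only:)
    have le: "norm (?d j) \<le> (K * sqrt (norm z)) * ?p j" for j
    proof -
      have "norm (bernoulli_remainder (of_real (real (2 * j + 1)) * z)
          - bernoulli_remainder (of_real (real (2 * j + 1) + 1) * z))
          \<le> K * (real (2 * j + 1) * norm z) powr (- 3 / 2) * norm z"
        by (rule bernoulli_remainder_difference_le[OF K z]) auto
      moreover have "complex_of_real (real (2 * j + 1) + 1) = of_nat (2 * j + 2)"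
        "complex_of_real (real (2 * j + 1)) = of_nat (2 * j + 1)" by simp_all
      ultimately have "norm (bernoulli_remainder (of_nat (2 * j + 1) * z)
          - bernoulli_remainder (of_nat (2 * j + 2) * z))
          \<le> K * (real (2 * j + 1) * norm z) powr (- 3 / 2) * norm z" by (simp only:)
      then have "norm (?d j) \<le> norm z * (K * (real (2 * j + 1) * norm z) powr (- 3 / 2) * norm z)"
        unfolding norm_mult by (intro mult_left_mono) auto
      also have "(real (2 * j + 1) * norm z) powr (- 3 / 2) = ?p j * norm z powr (- 3 / 2)"
        by (rule powr_mult)
      also have "norm z * (K * (?p j * norm z powr (- 3 / 2)) * norm z)
          = K * (norm z powr (- 3 / 2) * (norm z * norm z)) * ?p j" by (simp only: mult_ac)
      also have "norm z powr (- 3 / 2) * (norm z * norm z) = sqrt (norm z)"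
      proof -
        have "norm z * norm z = norm z powr 2" using z0 by (simp add: powr_numeral power2_eq_square)
        then have "norm z powr (- 3 / 2) * (norm z * norm z) = norm z powr (- 3 / 2 + 2)"
          by (simp only: powr_add)
        then show ?thesis using z0 by (simp add: powr_half_sqrt)
      qed
      finally show ?thesis .
    qed
    have sm: "summable (\<lambda>j. (K * sqrt (norm z)) * ?p j)" by (intro summable_mult sp)
    then have sn: "summable (\<lambda>j. norm (?d j))"
      by (rule summable_comparison_test') (use le in simp)
    have "norm (partition_log q - (of_real (pi\<^sup>2 / 12) / z - of_real (ln 2) / 2)) \<le> (\<Sum>j. norm (?d j))"
      using summable_norm[OF sn] sums_unique[OF sd] by simp
    also have "\<dots> \<le> (\<Sum>j. (K * sqrt (norm z)) * ?p j)" by (rule suminf_le[OF le sn sm])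
    also have "\<dots> = K * sqrt (norm z) * B" unfolding B_def by (rule suminf_mult[OF sp])
    finally show ?thesis by (simp add: q_def mult_ac)
  qed
  show ?thesis by (rule that[of "K * B"]) (use K B main in auto)
qed

section \<open>Tools for the saddle point integral\<close>

text \<open>From \<open>1 - cos \<theta> = 2 * (sin (\<theta> / 2))\<^sup>2\<close> and
  \<open>sin y \<ge> y - y^3 / 6 \<ge> y / 3\<close> for
  \<open>0 \<le> y \<le> 2\<close>.\<close>

lemma one_minus_cos_ge:
  assumes "\<bar>\<theta>\<bar> \<le> pi"
  shows "\<theta>\<^sup>2 / 18 \<le> 1 - cos \<theta>"
proof -
  define y where "y = \<bar>\<theta>\<bar> / 2"
  have y: "0 \<le> y" "y \<le> 2" using assms pi_less_4 by (simp_all add: y_def)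
  have "(\<Sum>m<3. sin_coeff m * y ^ m) = y" by (simp add: sin_coeff_def numeral_3_eq_3)
  then have "\<bar>sin y - y\<bar> \<le> y ^ 3 / 6"
    using Maclaurin_sin_bound[of y 3] y by (simp add: fact_numeral)
  moreover have "y ^ 3 \<le> 4 * y"
  proof -
    have "y * y\<^sup>2 \<le> y * 2\<^sup>2" using y by (intro mult_left_mono power_mono) auto
    then show ?thesis by (simp add: power3_eq_cube power2_eq_square mult_ac)
  qed
  ultimately have "y / 3 \<le> sin y" by linarith
  then have "(y / 3)\<^sup>2 \<le> (sin y)\<^sup>2" using y by (intro power_mono) auto
  moreover have "cos \<theta> = 1 - 2 * (sin y)\<^sup>2"
    using cos_double_sin[of y] by (simp add: y_def)
  moreover have "(y / 3)\<^sup>2 = \<theta>\<^sup>2 / 36" by (simp add: y_def power_divide)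
  ultimately show ?thesis by simp
qed

lemma exp_diff_le:
  assumes "0 < t" "t \<le> (1::real)"
  shows "exp t - exp (- t) \<le> 3 * t"
proof -
  have "exp t \<le> 1 + t + t\<^sup>2" using assms by (intro exp_bound) auto
  moreover have "t\<^sup>2 \<le> t" using assms by (simp add: power2_eq_square mult_left_le)
  moreover have "1 + - t \<le> exp (- t)" by (rule exp_ge_add_one_self)
  ultimately show ?thesis by linarith
qed

text \<open>The power \<open>t^3\<close> is what turns a bound on \<open>t^3 * u\<^sup>2\<close>
  into decay like \<open>1 / u\<^sup>2\<close>.\<close>

lemma exp_minus_inverse_le:
  assumes "0 < (t::real)"
  shows "exp (- (1 / (6 * t))) \<le> 5832 * t ^ 3"
proof -
  \<comment> \<open>a third of the exponent, because \<open>y \<le> exp y\<close> is to be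
    cubed\<close>
  define y where "y = 1 / (18 * t)"
  have y: "0 < y" using assms by (simp add: y_def)
  have "y \<le> exp y" using exp_ge_add_one_self[of y] by linarith
  then have "y ^ 3 \<le> exp y ^ 3" using y by (intro power_mono) auto
  also have "\<dots> = exp (1 / (6 * t))" by (simp add: y_def flip: exp_of_nat_mult)
  finally have "inverse (exp (1 / (6 * t))) \<le> inverse (y ^ 3)" using y by (intro le_imp_inverse_le) auto
  also have "inverse (y ^ 3) = (18 * t) ^ 3" by (simp add: y_def power_divide)
  also have "\<dots> = 5832 * t ^ 3" by (simp add: power_mult_distrib)
  finally show ?thesis by (simp only: exp_minus)
qed

text \<open>With \<open>\<theta> = t powr (3/2) * u\<close> the exponent is at least a constant
  times \<open>u\<^sup>2 / (1 + t * u\<^sup>2)\<close>. If \<open>t * u\<^sup>2\<close> is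
  bounded, this is of order \<open>u\<^sup>2\<close>, as expected near a saddle point. Otherwise it is
  of order \<open>1 / t\<close>, so the exponential is \<open>O(t^3)\<close>, and
  \<open>t^3 * u\<^sup>2 = \<theta>\<^sup>2\<close> is bounded on the circle.\<close>

lemma exp_minus_deficit_le:
  fixes t u :: real
  assumes t: "0 < t" "t \<le> 1" and u: "\<bar>t * sqrt t * u\<bar> \<le> pi"
  defines "S \<equiv> exp t - exp (- t)" and "x \<equiv> 1 - cos (t * sqrt t * u)"
  shows "exp (- (4 * x / (S * (S\<^sup>2 + 4 * x)))) \<le> 100000 / (1 + u\<^sup>2)"
proof -
  define x0 where "x0 = t ^ 3 * u\<^sup>2 / 18"
  have sq: "(t * sqrt t * u)\<^sup>2 = t ^ 3 * u\<^sup>2"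
    using t by (simp add: power_mult_distrib power3_eq_cube power2_eq_square)
  have x0: "0 \<le> x0" "x0 \<le> x"
    using one_minus_cos_ge[OF u] t by (auto simp: x0_def x_def sq)
  have S: "0 < S" "S \<le> 3 * t" using t exp_diff_le[OF t] by (auto simp: S_def)
  \<comment> \<open>the value of the exponent when \<open>x\<close> is replaced by its lower bound
    \<open>x0\<close> and \<open>S\<close> by its upper bound \<open>3 * t\<close>\<close>
  define \<delta> where "\<delta> = 2 * u\<^sup>2 / (3 * (81 + 2 * t * u\<^sup>2))"
  have "\<delta> = 4 * x0 / (3 * t * ((3 * t)\<^sup>2 + 4 * x0))"
  proof -
    have "3 * t * ((3 * t)\<^sup>2 + 4 * x0) = t ^ 3 / 9 * (3 * (81 + 2 * t * u\<^sup>2))"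
      by (simp add: x0_def algebra_simps power2_eq_square power3_eq_cube)
    moreover have "4 * x0 = t ^ 3 / 9 * (2 * u\<^sup>2)" by (simp add: x0_def)
    ultimately have "4 * x0 / (3 * t * ((3 * t)\<^sup>2 + 4 * x0))
        = (t ^ 3 / 9 * (2 * u\<^sup>2)) / (t ^ 3 / 9 * (3 * (81 + 2 * t * u\<^sup>2)))" by (simp only:)
    also have "\<dots> = \<delta>"
      unfolding \<delta>_def by (rule mult_divide_mult_cancel_left) (use t in simp)
    finally show ?thesis by simp
  qed
  also have "\<dots> \<le> 4 * x0 / (S * (S\<^sup>2 + 4 * x0))"
    using S x0 by (intro divide_left_mono mult_mono add_mono power_mono mult_pos_pos
        add_pos_nonneg) auto
  also have "\<dots> \<le> 4 * x / (S * (S\<^sup>2 + 4 * x))"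
  proof -
    have p: "0 < S\<^sup>2 + 4 * x0" "0 < S\<^sup>2 + 4 * x" using S x0 by (auto intro!: add_pos_nonneg)
    have "x0 * (S\<^sup>2 + 4 * x) \<le> x * (S\<^sup>2 + 4 * x0)"
      using mult_right_mono[OF x0(2), of "S\<^sup>2"] by (simp add: algebra_simps)
    then have "x0 / (S\<^sup>2 + 4 * x0) \<le> x / (S\<^sup>2 + 4 * x)"
      using p by (simp add: divide_simps)
    then have "4 / S * (x0 / (S\<^sup>2 + 4 * x0)) \<le> 4 / S * (x / (S\<^sup>2 + 4 * x))"
      using S by (intro mult_left_mono) auto
    then show ?thesis by simp
  qed
  finally have "exp (- (4 * x / (S * (S\<^sup>2 + 4 * x)))) \<le> exp (- \<delta>)" by simp
  also have "\<dots> \<le> 100000 / (1 + u\<^sup>2)"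
  proof (cases "2 * t * u\<^sup>2 \<le> 81")
    case True
    have "u\<^sup>2 / 243 = 2 * u\<^sup>2 / (3 * (81 + 81))" by simp
    also have "\<dots> \<le> \<delta>" unfolding \<delta>_def
      using True t by (intro divide_left_mono mult_left_mono add_left_mono mult_pos_pos
          add_pos_nonneg) auto
    finally have d: "u\<^sup>2 / 243 \<le> \<delta>" .
    have "1 / exp \<delta> \<le> 1 / ((1 + u\<^sup>2) / 243)"
    proof (rule divide_left_mono)
      have "(1 + u\<^sup>2) / 243 \<le> 1 + u\<^sup>2 / 243" by simp
      also have "\<dots> \<le> 1 + \<delta>" using d by simp
      also have "\<dots> \<le> exp \<delta>" by (rule exp_ge_add_one_self)
      finally show "(1 + u\<^sup>2) / 243 \<le> exp \<delta>" .
      have "0 < 1 + u\<^sup>2" by (intro add_pos_nonneg) auto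
      then show "0 < exp \<delta> * ((1 + u\<^sup>2) / 243)" by simp
    qed simp
    also have "1 / ((1 + u\<^sup>2) / 243) = 243 / (1 + u\<^sup>2)" by simp
    also have "\<dots> \<le> 100000 / (1 + u\<^sup>2)" by (intro divide_right_mono) auto
    finally show ?thesis by (simp only: exp_minus inverse_eq_divide)
  next
    case False
    then have "u \<noteq> 0" by auto
    then have u0: "u\<^sup>2 > 0" by simp
    have "1 / (6 * t) = 2 * u\<^sup>2 / (3 * (2 * t * u\<^sup>2 + 2 * t * u\<^sup>2))"
      using u0 t by simp
    also have "\<dots> \<le> \<delta>" unfolding \<delta>_def
      using False t u0 by (intro divide_left_mono mult_left_mono add_right_mono mult_pos_pos
          add_pos_pos) auto
    finally have d: "1 / (6 * t) \<le> \<delta>" .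
    have "exp (- \<delta>) \<le> exp (- (1 / (6 * t)))" using d by simp
    also have "\<dots> \<le> 5832 * t ^ 3" by (rule exp_minus_inverse_le[OF t(1)])
    also have "\<dots> \<le> 100000 / (1 + u\<^sup>2)"
    proof (subst pos_le_divide_eq)
      show "0 < 1 + u\<^sup>2" by (intro add_pos_nonneg) auto
      have "t ^ 3 * u\<^sup>2 \<le> 4\<^sup>2"
        unfolding sq[symmetric] using u pi_less_4 by (intro power2_le_iff_abs_le[THEN iffD2]) auto
      moreover have "t ^ 3 \<le> 1" using t by (intro power_le_one) auto
      ultimately have "t ^ 3 + t ^ 3 * u\<^sup>2 \<le> 17" by simp
      then have "5832 * (t ^ 3 + t ^ 3 * u\<^sup>2) \<le> 5832 * 17" by (rule mult_left_mono) simp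
      then have "5832 * (t ^ 3 + t ^ 3 * u\<^sup>2) \<le> 100000" by (rule order_trans) simp
      then show "5832 * t ^ 3 * (1 + u\<^sup>2) \<le> 100000"
        by (simp only: distrib_left mult.assoc mult_1_right)
    qed
    finally show ?thesis .
  qed
  finally show ?thesis .
qed

lemma integral_cis_period:
  "(LINT \<theta>|lborel. indicator {- pi..pi} \<theta> *\<^sub>R cis (of_int m * \<theta>)) = (if m
      = 0 then of_real (2 * pi) else 0)"
proof (cases "m = 0")
  case True
  then show ?thesis by (simp add: scaleR_conv_of_real)
next
  case False
  let ?F = "\<lambda>\<theta>. exp (\<i> * of_int m * of_real \<theta>) / (\<i> * of_int m)"
  have c: "cis (of_int m * \<theta>) = exp (\<i> * of_int m * of_real \<theta>)" for \<theta>
    by (simp add: cis_conv_exp mult_ac)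
  have "(LINT \<theta>|lborel. indicator {- pi..pi} \<theta> *\<^sub>R exp (\<i> * of_int m * of_real \<theta>)) = ?F pi - ?F (- pi)"
  proof (rule integral_FTC_Icc)
    fix x
    show "(?F has_vector_derivative exp (\<i> * of_int m * of_real x)) (at x within {- pi..pi})"
      by (rule has_vector_derivative_real_field[where f
          = "\<lambda>z. exp (\<i> * of_int m * z) / (\<i> * of_int m)"])
         (use False in \<open>auto intro!: derivative_eq_intros\<close>)
  qed (auto intro!: continuous_intros)
  also have "exp (\<i> * of_int m * of_real pi) = exp (\<i> * of_int m * of_real (- pi))"
  proof -
    have "\<i> * of_int m * of_real pi = \<i> * of_int m * of_real (- pi) + (of_int (2 * m)
        * (of_real pi * \<i>))"
      by (simp add: algebra_simps)
    then show ?thesis unfolding exp_eq by (intro exI[of _ m]) simp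
  qed
  finally show ?thesis using False by (simp add: c)
qed

text \<open>Cauchy's formula for the coefficients of a power series, by termwise integration over the
  circle.\<close>

lemma coefficient_integral:
  fixes a :: "nat \<Rightarrow> complex" and r :: real
  assumes r: "0 \<le> r" and sm: "summable (\<lambda>k. norm (a k) * r ^ k)"
  shows "(LINT \<theta>|lborel. indicator {- pi..pi} \<theta> *\<^sub>R
            ((\<Sum>k. a k * (of_real r * cis \<theta>) ^ k) * cis (- real n * \<theta>)))
                = of_real (2 * pi * r ^ n) * a n"
proof -
  let ?f = "\<lambda>k \<theta>. indicator {- pi..pi} \<theta> *\<^sub>R (a k * of_real (r ^ k) * cis (of_int (int k - int n) * \<theta>))"
  have int: "integrable lborel (?f k)" for k
  proof -
    have "continuous_on {- pi..pi} (\<lambda>\<theta>. a k * of_real (r ^ k) * cis (of_int (int k - int n) * \<theta>))"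
      by (intro continuous_intros)
    then show ?thesis
      using borel_integrable_atLeastAtMost' unfolding set_integrable_def by blast
  qed
  have nf: "norm (?f k \<theta>) = indicator {- pi..pi} \<theta> * (norm (a k) * r ^ k)" for k \<theta>
    using r by (simp add: norm_mult norm_power indicator_def)
  have eq: "(\<Sum>k. ?f k \<theta>) = indicator {- pi..pi} \<theta> *\<^sub>R
            ((\<Sum>k. a k * (of_real r * cis \<theta>) ^ k) * cis (- real n * \<theta>))" for \<theta>
  proof -
    have "summable (\<lambda>k. norm (a k * (of_real r * cis \<theta>) ^ k))"
      using sm r by (simp add: norm_mult norm_power)
    then have s: "summable (\<lambda>k. a k * (of_real r * cis \<theta>) ^ k)" by (rule summable_norm_cancel)
    have "?f k \<theta> = indicator {- pi..pi} \<theta> *\<^sub>R (a k * (of_real r * cis \<theta>) ^ k * cis (- real n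
        * \<theta>))" for k
    proof -
      have "cis (of_int (int k - int n) * \<theta>) = cis \<theta> ^ k * cis (- real n * \<theta>)"
      proof -
        have "of_int (int k - int n) * \<theta> = real k * \<theta> + - real n * \<theta>"
          by (simp add: algebra_simps)
        then show ?thesis by (simp only: Complex.DeMoivre cis_mult)
      qed
      then show ?thesis by (simp add: power_mult_distrib)
    qed
    then have "(\<Sum>k. ?f k \<theta>) = (\<Sum>k. indicator {- pi..pi} \<theta> *\<^sub>R (a k * (of_real r * cis \<theta>) ^ k
        * cis (- real n * \<theta>)))"
      by (simp only:)
    also have "\<dots> = indicator {- pi..pi} \<theta> *\<^sub>R (\<Sum>k. a k * (of_real r * cis \<theta>) ^ k * cis (- real n * \<theta>))"
      by (rule suminf_scaleR_right[symmetric]) (intro summable_mult2 s)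
    also have "(\<Sum>k. a k * (of_real r * cis \<theta>) ^ k * cis (- real n * \<theta>))
       = (\<Sum>k. a k * (of_real r * cis \<theta>) ^ k) * cis (- real n * \<theta>)"
      by (rule suminf_mult2[symmetric, OF s])
    finally show ?thesis .
  qed
  have intf: "(LINT \<theta>|lborel. ?f k \<theta>) = (if k = n then of_real (2 * pi * r ^ n) * a n else 0)" for k
  proof -
    have "(LINT \<theta>|lborel. ?f k \<theta>) = (LINT \<theta>|lborel. (a k * of_real (r ^ k)) *
        (indicator {- pi..pi} \<theta> *\<^sub>R cis (of_int (int k - int n) * \<theta>)))"
      by (simp add: mult_scaleR_right)
    also have "\<dots> = (a k * of_real (r ^ k)) * (if int k - int n = 0 then of_real (2 * pi) else 0)"
      by (subst integral_mult_right_zero) (simp only: integral_cis_period)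
    finally show ?thesis by simp
  qed
  have "(\<lambda>k. LINT \<theta>|lborel. ?f k \<theta>) sums (LINT \<theta>|lborel. (\<Sum>k. ?f k \<theta>))"
  proof (rule sums_integral)
    show "AE \<theta> in lborel. summable (\<lambda>k. norm (?f k \<theta>))"
      unfolding nf using sm by (auto intro!: summable_mult)
    show "summable (\<lambda>k. LINT \<theta>|lborel. norm (?f k \<theta>))"
      unfolding nf using sm by (auto intro!: summable_mult)
  qed (rule int)
  then have "(\<lambda>k. if k = n then of_real (2 * pi * r ^ n) * a n else 0) sums
     (LINT \<theta>|lborel. indicator {- pi..pi} \<theta> *\<^sub>R
            ((\<Sum>k. a k * (of_real r * cis \<theta>) ^ k) * cis (- real n * \<theta>)))"
    unfolding intf eq .
  moreover have "(\<lambda>k. if k = n then of_real (2 * pi * r ^ n) * a n else 0)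
      sums (of_real (2 * pi * r ^ n) * a n)"
    by (rule sums_single)
  ultimately show ?thesis by (rule sums_unique2)
qed

lemma integrable_inverse_one_plus_square: "integrable lborel (\<lambda>x::real. K / (1 + x\<^sup>2))"
  using integrable_inverse_1_plus_square
  by (simp add: set_integrable_def divide_inverse)

text \<open>The density of the normal distribution with variance \<open>1 / (2 * A)\<close> has total
  mass 1.\<close>

lemma integral_exp_minus_square:
  assumes "0 < A"
  shows "(LINT u|lborel. exp (- A * u\<^sup>2)) = sqrt (pi / A)"
proof -
  \<comment> \<open>the standard deviation for which \<open>1 / (2 * \<sigma>\<^sup>2) =
    A\<close>\<close>
  define \<sigma> where "\<sigma> = 1 / sqrt (2 * A)"
  have \<sigma>: "2 * \<sigma>\<^sup>2 = 1 / A" "0 < \<sigma>" using assms by (simp_all add: \<sigma>_def power_divide)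
  have "normal_density 0 \<sigma> u = 1 / sqrt (pi / A) * exp (- A * u\<^sup>2)" for u
  proof -
    have "2 * pi * \<sigma>\<^sup>2 = pi / A" using \<sigma>(1) by (simp add: field_simps)
    then show ?thesis by (simp add: normal_density_def \<sigma>(1))
  qed
  then have "(LINT u|lborel. 1 / sqrt (pi / A) * exp (- A * u\<^sup>2)) = 1"
    using integral_normal_density[OF \<sigma>(2), of 0] by (simp only:)
  then have "1 / sqrt (pi / A) * (LINT u|lborel. exp (- A * u\<^sup>2)) = 1"
    by (simp only: integral_mult_right_zero)
  then show ?thesis using assms by (simp add: field_simps)
qed

section \<open>The saddle point method\<close>

text \<open>The minimiser of \<open>\<pi>\<^sup>2 / (12 * t) + n * t\<close> over \<open>t >
  0\<close>.\<close>

definition saddle :: "nat \<Rightarrow> real" where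
  "saddle n = pi / sqrt (12 * real n)"

lemma saddle_bounds:
  assumes "0 < n"
  shows "0 < saddle n" "saddle n \<le> 1"
proof -
  show "0 < saddle n" using assms by (simp add: saddle_def)
  have "pi \<le> sqrt (12 * real n)"
  proof (rule real_le_rsqrt)
    have "pi\<^sup>2 \<le> 3.2\<^sup>2" using pi_approx by (intro power_mono) auto
    also have "\<dots> \<le> 12 * 1" by (simp add: power2_eq_square)
    also have "\<dots> \<le> 12 * real n" using assms by (intro mult_left_mono) auto
    finally show "pi\<^sup>2 \<le> 12 * real n" .
  qed
  then show "saddle n \<le> 1" using assms by (simp add: saddle_def)
qed

text \<open>At the minimum the two summands of \<open>\<pi>\<^sup>2 / (12 * t) + n * t\<close>
  agree.\<close>

lemma saddle_equation:
  assumes "0 < n"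
  shows "real n * saddle n = (pi\<^sup>2 / 12) / saddle n"
proof -
  have "(saddle n)\<^sup>2 = pi\<^sup>2 / (12 * real n)" by (simp add: saddle_def power_divide)
  then have "real n * (saddle n * saddle n) = pi\<^sup>2 / 12" using assms by (simp add: power2_eq_square)
  then show ?thesis using saddle_bounds(1)[OF assms] by (simp add: field_simps)
qed

lemma saddle_tendsto: "saddle \<longlonglongrightarrow> 0"
  unfolding saddle_def by real_asymp

lemma convolution_power_series:
  fixes c d :: "nat \<Rightarrow> real"
  assumes c: "\<And>k. 0 \<le> c k" "\<And>k. c k \<le> B" and d: "\<And>k. 0 \<le> d k"
    and gf: "\<And>q::complex. norm q < 1 \<Longrightarrow> (\<lambda>n. of_real (d n) * q ^ n) sums exp (partition_log q)"
    and q: "norm (q::complex) < 1"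
  defines "a \<equiv> \<lambda>n. \<Sum>k\<le>n. c k * d (n - k)"
  shows "summable (\<lambda>n. norm (of_real (a n) :: complex) * norm q ^ n)"
    and "(\<lambda>n. of_real (a n) * q ^ n) sums ((\<Sum>k. of_real (c k) * q ^ k) * exp (partition_log q))"
proof -
  have B: "0 \<le> B" using c[of 0] by linarith
  have sc: "summable (\<lambda>k. norm (of_real (c k) * q ^ k))" if "norm q < 1" for q :: complex
  proof (rule summable_comparison_test'[of "\<lambda>k. B * norm q ^ k" 0])
    show "summable (\<lambda>k. B * norm q ^ k)" using that by (intro summable_mult summable_geometric) auto
    show "norm (norm (of_real (c k) * q ^ k)) \<le> B * norm q ^ k" for k
      using c[of k] by (simp add: norm_mult norm_power mult_right_mono)
  qed
  have sd: "summable (\<lambda>k. norm (of_real (d k) * q ^ k))" if "norm q < 1" for q :: complex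
  proof -
    have "summable (\<lambda>n. of_real (d n) * (of_real (norm q) :: complex) ^ n)"
      using gf[of "of_real (norm q)"] that by (auto simp: sums_iff)
    then have "summable (\<lambda>n. complex_of_real (d n * norm q ^ n))" by simp
    then have "summable (\<lambda>n. d n * norm q ^ n)" by (simp only: summable_of_real_iff)
    then show ?thesis using d by (simp add: norm_mult norm_power)
  qed
  have trm: "(\<Sum>i\<le>n. (of_real (c i) * q ^ i) * (of_real (d (n - i)) * q ^ (n - i)))
      = of_real (a n) * q ^ n"
    for n and q :: complex
  proof -
    have "(of_real (c i) * q ^ i) * (of_real (d (n - i)) * q ^ (n - i))
        = of_real (c i * d (n - i)) * q ^ n"
      if "i \<le> n" for i
    proof -
      have "q ^ i * q ^ (n - i) = q ^ n" using that by (simp add: power_add[symmetric])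
      then have "of_real (c i * d (n - i)) * (q ^ i * q ^ (n - i)) = of_real (c i * d (n - i)) * q ^ n"
        by (simp only:)
      then show ?thesis by (simp only: of_real_mult mult_ac)
    qed
    then have "(\<Sum>i\<le>n. (of_real (c i) * q ^ i) * (of_real (d (n - i)) * q ^ (n - i)))
        = (\<Sum>i\<le>n. of_real (c i * d (n - i)) * q ^ n)" by (intro sum.cong) auto
    then show ?thesis by (simp only: a_def sum_distrib_right[symmetric] of_real_sum)
  qed
  show "(\<lambda>n. of_real (a n) * q ^ n) sums ((\<Sum>k. of_real (c k) * q ^ k) * exp (partition_log q))"
    using Cauchy_product_sums[OF sc[OF q] sd[OF q]] sums_unique[OF gf[OF q]] unfolding trm by simp
  have "summable (\<lambda>n. \<Sum>i\<le>n. (of_real (c i) * of_real (norm q) ^ i) * (of_real (d (n - i))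
      * complex_of_real (norm q) ^ (n - i)))"
    by (rule summable_Cauchy_product[OF sc sd]) (use q in auto)
  then have "summable (\<lambda>n. complex_of_real (a n * norm q ^ n))" unfolding trm by simp
  then have "summable (\<lambda>n. a n * norm q ^ n)" by (simp only: summable_of_real_iff)
  moreover have "0 \<le> a n" for n unfolding a_def using c d by (intro sum_nonneg mult_nonneg_nonneg)
  ultimately show "summable (\<lambda>n. norm (of_real (a n) :: complex) * norm q ^ n)"
    by simp
qed

lemma norm_bounded_series_le:
  fixes c :: "nat \<Rightarrow> real"
  assumes c: "\<And>k. 0 \<le> c k" "\<And>k. c k \<le> B" and q: "norm (q::complex) < 1"
  shows "norm (\<Sum>k. of_real (c k) * q ^ k) \<le> B / (1 - norm q)"
proof -
  have s: "summable (\<lambda>k. B * norm q ^ k)" using q by (intro summable_mult summable_geometric) auto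
  have le: "norm (of_real (c k) * q ^ k) \<le> B * norm q ^ k" for k
    using c[of k] by (simp add: norm_mult norm_power mult_right_mono)
  have s': "summable (\<lambda>k. norm (of_real (c k) * q ^ k))"
    by (rule summable_comparison_test'[OF s, of 0]) (use le in simp)
  have "norm (\<Sum>k. of_real (c k) * q ^ k) \<le> (\<Sum>k. norm (of_real (c k) * q ^ k))"
    by (rule summable_norm[OF s'])
  also have "\<dots> \<le> (\<Sum>k. B * norm q ^ k)" by (rule suminf_le[OF le s' s])
  also have "\<dots> = B / (1 - norm q)" using q by (simp add: suminf_mult suminf_geometric)
  finally show ?thesis .
qed

text \<open>The weights enter only through their bound and through the behaviour \<open>\<kappa> /
  z\<close> of their power series at \<open>exp (- z)\<close>. With \<open>t\<close> the saddle point
  and \<open>A = \<pi>\<^sup>2 / 12\<close>, the rescaled integrand \<open>g n u\<close> below is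
  the integrand of Cauchy's formula at \<open>\<theta> = t powr (3/2) * u\<close>, multiplied by
  \<open>t * exp (- A / t)\<close>, the reciprocal of its size at \<open>u = 0\<close> up to a
  constant.\<close>

theorem convolution_asymptotics:
  fixes c d :: "nat \<Rightarrow> real" and \<kappa> :: real
  assumes c: "\<And>k. 0 \<le> c k" "\<And>k. c k \<le> B" and d: "\<And>k. 0 \<le> d k"
    and gf: "\<And>q::complex. norm q < 1 \<Longrightarrow> (\<lambda>n. of_real (d n) * q ^ n) sums exp (partition_log q)"
    and pole: "((\<lambda>z. z * (\<Sum>k. of_real (c k) * exp (- z) ^ k)) \<longlongrightarrow> of_real \<kappa>) (at 0 within {z. 0 < Re z})"
    and \<kappa>: "0 < \<kappa>"
  shows "(\<lambda>n. \<Sum>k\<le>n. c k * d (n - k)) \<sim>[at_top]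
     (\<lambda>n. \<kappa> * 3 powr (1 / 4) / (2 * pi * real n powr (1 / 4)) * exp (pi * sqrt (real n / 3)))"
proof -
  define a where "a = (\<lambda>n. \<Sum>k\<le>n. c k * d (n - k))"
  define A :: real where "A = pi\<^sup>2 / 12"
  define C where "C = (\<lambda>q::complex. \<Sum>k. of_real (c k) * q ^ k)"
  define q where "q = (\<lambda>t u. of_real (exp (- t)) * cis (t * sqrt t * u))"
  define g :: "nat \<Rightarrow> real \<Rightarrow> complex" where "g = (\<lambda>n u. let t = saddle n in
     indicator {u. \<bar>t * sqrt t * u\<bar> \<le> pi} u *\<^sub>R
       (of_real (t * exp (- A / t)) * (C (q t u) * exp (partition_log (q t u)) * cis (- real n
           * (t * sqrt t * u)))))"
  obtain K where K: "0 < K" "\<And>z. 0 < Re z \<Longrightarrow> \<bar>Im z\<bar> \<le> Re z \<Longrightarrow>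
       norm (partition_log (exp (- z)) - (of_real (pi\<^sup>2 / 12) / z - of_real (ln 2 / 2)))
           \<le> K * sqrt (norm z)"
    using partition_log_asymptotics by blast
  have A: "0 < A" by (simp add: A_def)
  have B: "0 \<le> B" using c[of 0] by linarith
  have nq: "norm (q t u) = exp (- t)" for t u by (simp add: q_def norm_mult)

  have integral_g: "(LINT u|lborel. g n u)
      = of_real (2 * pi * a n * exp (- 2 * A / saddle n) / sqrt (saddle n))" if n: "0 < n" for n
  proof -
    define t where "t = saddle n"
    have t: "0 < t" using saddle_bounds[OF n] by (simp add: t_def)
    let ?w = "t * sqrt t"
    have w: "0 < ?w" using t by simp
    let ?f = "\<lambda>\<theta>. indicator {- pi..pi} \<theta> *\<^sub>R
            ((\<Sum>k. of_real (a k) * (of_real (exp (- t)) * cis \<theta>) ^ k) * cis (- real n * \<theta>))"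
    have sm: "summable (\<lambda>k. norm (of_real (a k) :: complex) * exp (- t) ^ k)"
      using convolution_power_series(1)[OF c d gf, of "of_real (exp (- t))"] t by (simp add: a_def)
    have f: "?f (0 + ?w * u) = of_real (exp (A / t) / t) * g n u" for u
    proof -
      have "(\<lambda>k. of_real (a k) * q t u ^ k) sums (C (q t u) * exp (partition_log (q t u)))"
        using convolution_power_series(2)[OF c d gf, of "q t u"] t unfolding a_def C_def
            by (simp add: nq)
      then have s: "(\<Sum>k. of_real (a k) * (of_real (exp (- t)) * cis (0 + ?w * u)) ^ k)
          = C (q t u) * exp (partition_log (q t u))"
        by (simp add: sums_iff q_def)
      have i: "indicator {- pi..pi} (0 + ?w * u) = (indicator {u. \<bar>?w * u\<bar> \<le> pi} u :: real)"
        by (auto simp: indicator_def)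
      have "complex_of_real (exp (A / t) / t) * of_real (t * exp (- A / t))
          = of_real (exp (A / t + - A / t))"
        unfolding exp_add of_real_mult[symmetric] using t by simp
      then have e: "complex_of_real (exp (A / t) / t) * of_real (t * exp (- A / t)) = 1" by simp
      have "of_real (exp (A / t) / t) * g n u = (complex_of_real (exp (A / t) / t) * of_real (t
          * exp (- A / t))) *
          (indicator {u. \<bar>?w * u\<bar> \<le> pi} u *\<^sub>R
             (C (q t u) * exp (partition_log (q t u)) * cis (- real n * (?w * u))))"
        unfolding g_def Let_def t_def[symmetric] by (simp only: mult_scaleR_right mult.assoc)
      then show ?thesis
        unfolding s i e by simp
    qed
    have "of_real (2 * pi * exp (- t) ^ n) * of_real (a n) = (LINT \<theta>|lborel. ?f \<theta>)"
      by (rule coefficient_integral[OF _ sm, symmetric]) simp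
    also have "\<dots> = \<bar>?w\<bar> *\<^sub>R (LINT u|lborel. ?f (0 + ?w * u))"
      by (rule lborel_integral_real_affine) (use t in simp)
    also have "\<dots> = ?w *\<^sub>R (LINT u|lborel. of_real (exp (A / t) / t) * g n u)"
      unfolding f using w by (simp only: abs_of_pos)
    also have "\<dots> = ?w *\<^sub>R (of_real (exp (A / t) / t) * (LINT u|lborel. g n u))"
      by (simp only: integral_mult_right_zero)
    also have "\<dots> = of_real (?w * exp (A / t) / t) * (LINT u|lborel. g n u)"
      by (simp add: scaleR_conv_of_real)
    finally have "of_real (2 * pi * exp (- t) ^ n * a n)
        = of_real (?w * exp (A / t) / t) * (LINT u|lborel. g n u)"
      by (simp only: of_real_mult)
    also have "?w * exp (A / t) / t = sqrt t * exp (A / t)" using t by simp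
    finally have *: "of_real (2 * pi * exp (- t) ^ n * a n)
        = of_real (sqrt t * exp (A / t)) * (LINT u|lborel. g n u)" .
    have "exp (- t) ^ n = exp (- (A / t))"
      using saddle_equation[OF n] by (simp add: exp_of_nat_mult[symmetric] A_def t_def)
    moreover have "exp (- 2 * A / t) = exp (- (A / t)) / exp (A / t)"
      by (simp add: exp_diff[symmetric])
    ultimately have "of_real (2 * pi * a n * exp (- 2 * A / t) / sqrt t)
       = complex_of_real (2 * pi * exp (- t) ^ n * a n) / of_real (sqrt t * exp (A / t))"
      by (simp add: mult_ac)
    also have "\<dots> = (LINT u|lborel. g n u)" unfolding * using t by simp
    finally show ?thesis by (simp add: t_def)
  qed

  have g_bound: "norm (g n u) \<le> 2 * B * exp K * 100000 / (1 + u\<^sup>2)" if n: "0 < n" for n u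
  proof -
    define t where "t = saddle n"
    have t: "0 < t" "t \<le> 1" using saddle_bounds[OF n] by (simp_all add: t_def)
    show ?thesis
    proof (cases "\<bar>t * sqrt t * u\<bar> \<le> pi")
      case True
      have "t / 2 \<le> 1 - exp (- t)"
      proof -
        have "exp (- t) \<le> 1 / (1 + t)"
          using exp_ge_add_one_self[of t] t by (simp add: exp_minus inverse_eq_divide frac_le)
        moreover have "t / 2 \<le> 1 - 1 / (1 + t)" using t by (simp add: divide_simps)
        ultimately show ?thesis by linarith
      qed
      then have "B / (1 - exp (- t)) \<le> B / (t / 2)" using t B by (intro divide_left_mono) auto
      moreover have "norm (C (q t u)) \<le> B / (1 - norm (q t u))"
        unfolding C_def by (rule norm_bounded_series_le) (use c t in \<open>auto simp: nq\<close>)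
      ultimately have "norm (C (q t u)) \<le> 2 * B / t" by (simp add: nq mult.commute)
      then have 1: "t * norm (C (q t u)) \<le> 2 * B" using t by (simp add: field_simps)
      have "Re (partition_log (of_real (exp (- t)))) - A / t \<le> K"
      proof -
        have "Re (partition_log (exp (- of_real t)) - (of_real (pi\<^sup>2 / 12) / of_real t
            - of_real (ln 2 / 2)))
            \<le> K * sqrt (norm (complex_of_real t))"
          by (rule order_trans[OF complex_Re_le_cmod K(2)]) (use t in auto)
        moreover have "Re (of_real (pi\<^sup>2 / 12) / of_real t - of_real (ln 2 / 2)) = A / t - ln 2 / 2"
          by (simp add: A_def flip: of_real_divide)
        moreover have "exp (- of_real t) = complex_of_real (exp (- t))" by (simp flip: exp_of_real)
        ultimately have "Re (partition_log (of_real (exp (- t)))) - (A / t - ln 2 / 2) \<le> K * sqrt t"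
          using t by simp
        moreover have "K * sqrt t \<le> K * 1" using t K by (intro mult_left_mono) auto
        moreover have "0 \<le> ln (2::real)" by (rule ln_ge_zero) simp
        ultimately show ?thesis by linarith
      qed
      then have 2: "exp (Re (partition_log (of_real (exp (- t)))) - A / t) \<le> exp K" by simp
      let ?D = "exp (- t) / (1 - (exp (- t))\<^sup>2) - Re (q t u / (1 - (q t u)\<^sup>2))"
      have "norm (exp (partition_log (q t u))) \<le> exp (Re (partition_log (of_real (exp (- t)))) - ?D)"
        by (rule norm_exp_partition_log_le) (use t in \<open>auto simp: nq\<close>)
      then have "exp (- A / t) * norm (exp (partition_log (q t u))) \<le>
          exp (- A / t) * exp (Re (partition_log (of_real (exp (- t)))) - ?D)"
        by (rule mult_left_mono) simp
      also have "\<dots> = exp (Re (partition_log (of_real (exp (- t)))) - A / t) * exp (- ?D)"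
        by (simp add: mult_exp_exp algebra_simps)
      also have "\<dots> \<le> exp K * (100000 / (1 + u\<^sup>2))"
      proof (rule mult_mono[OF 2])
        have "exp (- ?D) \<le> exp (- (4 * (1 - cos (t * sqrt t * u)) /
            ((exp t - exp (- t)) * ((exp t - exp (- t))\<^sup>2 + 4 * (1 - cos (t * sqrt t * u))))))"
          using Re_deficit_ge[OF t(1), of "t * sqrt t * u"] by (simp add: q_def)
        then show "exp (- ?D) \<le> 100000 / (1 + u\<^sup>2)"
          using exp_minus_deficit_le[OF t True] by linarith
      qed auto
      finally have 3: "exp (- A / t) * norm (exp (partition_log (q t u)))
          \<le> exp K * (100000 / (1 + u\<^sup>2))" .
      have "norm (g n u) = (t * norm (C (q t u))) * (exp (- A / t)
          * norm (exp (partition_log (q t u))))"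
        unfolding g_def Let_def t_def[symmetric] using True t
        by (simp add: norm_mult del: of_real_mult of_real_divide norm_exp_eq_Re) 
      also have "\<dots> \<le> (2 * B) * (exp K * (100000 / (1 + u\<^sup>2)))"
        by (rule mult_mono[OF 1 3]) (use B in auto)
      finally show ?thesis by simp
    next
      case False
      then have "g n u = 0" unfolding g_def Let_def t_def[symmetric] by simp
      then show ?thesis using B by (simp add: add_nonneg_nonneg)
    qed
  qed

  have g_limit: "(\<lambda>n. g n u) \<longlonglongrightarrow> of_real (\<kappa> / sqrt 2 * exp (- A * u\<^sup>2))" for u
  proof -
    define v where "v = (\<lambda>n. 1 - \<i> * of_real (sqrt (saddle n) * u))"
    define z where "z = (\<lambda>n. of_real (saddle n) * v n)"
    have s0: "(\<lambda>n. sqrt (saddle n) * u) \<longlonglongrightarrow> 0"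
      using tendsto_mult[OF tendsto_real_sqrt[OF saddle_tendsto] tendsto_const[of u]] by simp
    have v1: "v \<longlonglongrightarrow> 1"
      unfolding v_def using tendsto_diff[OF tendsto_const tendsto_mult[OF tendsto_const
          tendsto_of_real[OF s0]], of 1 \<i>] by simp
    have z0: "z \<longlonglongrightarrow> 0"
      unfolding z_def using tendsto_mult[OF tendsto_of_real[OF saddle_tendsto] v1] by simp
    have "\<forall>\<^sub>F n in sequentially. \<bar>sqrt (saddle n) * u\<bar> < 1"
      using tendstoD[OF s0, of 1] by (simp add: dist_real_def)
    then have ev: "\<forall>\<^sub>F n in sequentially. 0 < n \<and> \<bar>sqrt (saddle n) * u\<bar> < 1"
      using eventually_gt_at_top[of 0] by eventually_elim auto
    have zRe: "0 < Re (z n)" and zIm: "\<bar>Im (z n)\<bar> \<le> Re (z n)" and eqz: "q (saddle n) u = exp (- z n)"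
      and vnz: "v n \<noteq> 0"
      if "0 < n" "\<bar>sqrt (saddle n) * u\<bar> < 1" for n
    proof -
      have t: "0 < saddle n" using saddle_bounds that by blast
      show "0 < Re (z n)" using t by (simp add: z_def v_def)
      have "saddle n * \<bar>sqrt (saddle n) * u\<bar> \<le> saddle n * 1"
        using that t by (intro mult_left_mono) auto
      then show "\<bar>Im (z n)\<bar> \<le> Re (z n)" using t by (simp add: z_def v_def abs_mult)
      have "- z n = of_real (- saddle n) + \<i> * of_real (saddle n * sqrt (saddle n) * u)"
        by (simp add: z_def v_def algebra_simps)
      then have "exp (- z n) = exp (of_real (- saddle n)) * exp (\<i> * of_real (saddle n
          * sqrt (saddle n) * u))"
        by (simp only: exp_add)
      then show "q (saddle n) u = exp (- z n)"
        unfolding q_def cis_conv_exp by (simp only: exp_of_real)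
      have "Re (v n) = 1" by (simp add: v_def)
      then show "v n \<noteq> 0" by auto
    qed
    have zlim: "filterlim z (at 0 within {z. 0 < Re z}) sequentially"
      unfolding filterlim_at
    proof
      show "\<forall>\<^sub>F n in sequentially. z n \<in> {z. 0 < Re z} \<and> z n \<noteq> 0"
        using ev
      proof eventually_elim
        case (elim n)
        then have "0 < Re (z n)" by (intro zRe) auto
        then show ?case by auto
      qed
    qed (rule z0)
    have L1: "(\<lambda>n. z n * C (exp (- z n))) \<longlonglongrightarrow> of_real \<kappa>"
      unfolding C_def by (rule filterlim_compose[OF pole zlim])
    have L2: "(\<lambda>n. partition_log (exp (- z n)) - (of_real A / z n - of_real (ln 2 / 2))) \<longlonglongrightarrow> 0"
    proof (rule Lim_null_comparison)
      show "\<forall>\<^sub>F n in sequentially. norm (partition_log (exp (- z n)) - (of_real A / z n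
          - of_real (ln 2 / 2))) \<le> K * sqrt (norm (z n))"
        using ev unfolding A_def by eventually_elim (intro K(2) zRe zIm, auto)
      show "(\<lambda>n. K * sqrt (norm (z n))) \<longlonglongrightarrow> 0"
        using tendsto_mult[OF tendsto_const tendsto_real_sqrt[OF tendsto_norm[OF z0]], of K] by simp
    qed
    have "(\<lambda>n. 1 / v n * (z n * C (exp (- z n))) *
          exp ((partition_log (exp (- z n)) - (of_real A / z n - of_real (ln 2 / 2)))
               + (- of_real (A * u\<^sup>2) / v n) - of_real (ln 2 / 2)))
        \<longlonglongrightarrow> 1 / 1 * of_real \<kappa> * exp (0 + (- of_real (A * u\<^sup>2) / 1) - of_real (ln 2 / 2))"
      by (intro tendsto_mult tendsto_exp tendsto_diff tendsto_add tendsto_divide tendsto_const v1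
          L1 L2) auto
    moreover have "1 / 1 * of_real \<kappa> * exp (0 + (- of_real (A * u\<^sup>2) / 1) - of_real (ln 2 / 2))
        = complex_of_real (\<kappa> / sqrt 2 * exp (- A * u\<^sup>2))"
    proof -
      have "exp (0 + (- of_real (A * u\<^sup>2) / 1) - of_real (ln 2 / 2))
          = complex_of_real (exp (- (A * u\<^sup>2) - ln 2 / 2))"
        by (simp only: exp_of_real[symmetric] of_real_diff of_real_minus div_by_1 add_0_left)
      also have "exp (- (A * u\<^sup>2) - ln 2 / 2) = exp (- (A * u\<^sup>2)) / sqrt 2"
        
      proof -
        have "exp (ln 2 / 2) = exp (ln (sqrt 2 :: real))" by (subst ln_sqrt) simp_all
        then show ?thesis by (simp add: exp_diff)
      qed
      finally show ?thesis by simp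
    qed
    moreover have "\<forall>\<^sub>F n in sequentially. 1 / v n * (z n * C (exp (- z n))) *
          exp ((partition_log (exp (- z n)) - (of_real A / z n - of_real (ln 2 / 2)))
               + (- of_real (A * u\<^sup>2) / v n) - of_real (ln 2 / 2)) = g n u"
      using ev
    proof eventually_elim
      case (elim n)
      define t where "t = saddle n"
      have t: "0 < t" "t \<le> 1" using saddle_bounds elim by (simp_all add: t_def)
      have E: "q t u = exp (- z n)" "v n \<noteq> 0" using eqz vnz elim by (auto simp: t_def)
      have zn: "z n = of_real t * v n" by (simp add: z_def t_def)
      have "\<bar>t * sqrt t * u\<bar> \<le> 1 * 1"
        unfolding mult.assoc abs_mult[of t] using t elim by (intro mult_mono) (auto simp: t_def)
      then have ind: "indicator {u. \<bar>t * sqrt t * u\<bar> \<le> pi} u = (1::real)"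
        using pi_gt3 by (simp add: indicator_def)
      have nt: "real n * t = A / t" using saddle_equation elim by (simp add: t_def A_def)
      \<comment> \<open>With \<open>v = 1 - \<i> * s\<close>, \<open>s = sqrt t * u\<close>
        and \<open>z = t * v\<close>, this is the identity \<open>A / z - A / t - \<i> * (A / t) * s
        = - A * u\<^sup>2 / v\<close>; its right-hand side tends to
        \<open>- A * u\<^sup>2\<close>.\<close>
      have expo: "(partition_log (exp (- z n)) - (of_real A / z n - of_real (ln 2 / 2)))
               + (- of_real (A * u\<^sup>2) / v n) - of_real (ln 2 / 2)
          = partition_log (exp (- z n)) + (- of_real (A / t) + \<i> * of_real (- real n * (t * sqrt t
              * u)))"
      proof -
        have "real n * (t * sqrt t * u) = (real n * t) * (sqrt t * u)" by simp
        also have "\<dots> = A / t * (sqrt t * u)" by (simp only: nt)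
        finally have n': "real n * (t * sqrt t * u) = A / t * (sqrt t * u)" .
        have sq: "(complex_of_real (sqrt t * u))\<^sup>2 = of_real (t * u\<^sup>2)"
          using t by (simp add: power_mult_distrib flip: of_real_power)
        define s where "s = complex_of_real (sqrt t * u)"
        have vs: "v n = 1 - \<i> * s" by (simp add: v_def s_def t_def)
        have "(of_real (A / t) + \<i> * (of_real (A / t) * s)) * v n = of_real (A / t) * (1 + s\<^sup>2)"
        proof -
          have "(x + \<i> * (x * s)) * (1 - \<i> * s) = x * (1 + s\<^sup>2)" for x
            by (simp add: algebra_simps power2_eq_square)
          then show ?thesis unfolding vs .
        qed
        also have "\<dots> = of_real (A / t) * (1 + of_real (t * u\<^sup>2))"
          by (simp only: s_def sq)
        also have "\<dots> = of_real (A / t * (1 + t * u\<^sup>2))" by simp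
        also have "A / t * (1 + t * u\<^sup>2) = A / t + A * u\<^sup>2" using t by (simp add: distrib_left)
        finally have "of_real (A / t) + \<i> * (of_real (A / t) * s)
            = (of_real (A / t) + of_real (A * u\<^sup>2)) / v n"
          using E by (simp only: eq_divide_eq of_real_add) simp
        also have "\<dots> = of_real A / z n + of_real (A * u\<^sup>2) / v n"
          by (simp add: zn add_divide_distrib)
        finally have "of_real A / z n + of_real (A * u\<^sup>2) / v n
            = of_real (A / t) + \<i> * (of_real (A / t) * s)" ..
        moreover have "\<i> * of_real (- real n * (t * sqrt t * u)) = - (\<i> * (of_real (A / t) * s))"
          using n' by (simp add: s_def flip: of_real_mult)
        ultimately show ?thesis by (simp add: algebra_simps)
      qed
      have "g n u = of_real t * exp (- of_real (A / t)) * (C (exp (- z n))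
          * exp (partition_log (exp (- z n))) *
          exp (\<i> * of_real (- real n * (t * sqrt t * u))))"
        unfolding g_def Let_def t_def[symmetric] ind E(1) cis_conv_exp by (simp flip: exp_of_real)
      also have "\<dots> = of_real t * C (exp (- z n)) * exp (partition_log (exp (- z n))
          + (- of_real (A / t) + \<i> * of_real (- real n * (t * sqrt t * u))))"
        unfolding exp_add by (simp only: mult_ac)
      also have "of_real t * C (exp (- z n)) = 1 / v n * (z n * C (exp (- z n)))"
        using E by (simp add: zn)
      finally show ?case unfolding expo ..
    qed
    ultimately show ?thesis by (simp add: tendsto_cong)
  qed

  have meas: "g n \<in> borel_measurable borel" if n: "0 < n" for n
  proof -
    define t where "t = saddle n"
    have t: "0 < t" using saddle_bounds[OF n] by (simp add: t_def)
    have F: "C (q t u) * exp (partition_log (q t u)) = (\<Sum>k. of_real (a k) * q t u ^ k)" for u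
      using convolution_power_series(2)[OF c d gf, of "q t u"] t unfolding a_def C_def
          by (simp add: nq sums_iff)
    have qm: "q t \<in> borel_measurable borel"
      unfolding q_def by (intro borel_measurable_continuous_onI continuous_intros)
    have cm: "(\<lambda>u. cis (- real n * (t * sqrt t * u))) \<in> borel_measurable borel"
      by (intro borel_measurable_continuous_onI continuous_intros)
    show ?thesis
      unfolding g_def Let_def t_def[symmetric] F using qm cm by measurable
  qed

  have "(\<lambda>n. LINT u|lborel. g (Suc n) u) \<longlonglongrightarrow> (LINT u|lborel. complex_of_real (\<kappa> / sqrt 2 * exp (- A
      * u\<^sup>2)))"
  proof (rule integral_dominated_convergence)
    show "integrable lborel (\<lambda>u::real. 2 * B * exp K * 100000 / (1 + u\<^sup>2))"
      by (rule integrable_inverse_one_plus_square)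
    show "AE u in lborel. (\<lambda>n. g (Suc n) u) \<longlonglongrightarrow> complex_of_real (\<kappa> / sqrt 2 * exp (- A * u\<^sup>2))"
      using g_limit by (auto intro!: AE_I2 LIMSEQ_Suc)
    show "AE u in lborel. norm (g (Suc n) u) \<le> 2 * B * exp K * 100000 / (1 + u\<^sup>2)" for n
      using g_bound[of "Suc n"] by auto
    show "g (Suc n) \<in> borel_measurable lborel" for n using meas[of "Suc n"] by simp
  qed measurable
  also have "(LINT u|lborel. complex_of_real (\<kappa> / sqrt 2 * exp (- A * u\<^sup>2)))
      = of_real (\<kappa> / sqrt 2 * sqrt (pi / A))"
    unfolding integral_complex_of_real by (simp only: integral_mult_right_zero
        integral_exp_minus_square[OF A])
  finally have "(\<lambda>n. LINT u|lborel. g n u) \<longlonglongrightarrow> of_real (\<kappa> / sqrt 2 * sqrt (pi / A))"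
    by (rule LIMSEQ_imp_Suc)
  moreover have "\<forall>\<^sub>F n in sequentially. (LINT u|lborel. g n u)
      = of_real (2 * pi * a n * exp (- 2 * A / saddle n) / sqrt (saddle n))"
    using eventually_gt_at_top[of 0] by eventually_elim (rule integral_g)
  ultimately have "(\<lambda>n. complex_of_real (2 * pi * a n * exp (- 2 * A / saddle n) / sqrt (saddle n)))
      \<longlonglongrightarrow> of_real (\<kappa> / sqrt 2 * sqrt (pi / A))"
    by (rule Lim_transform_eventually)
  then have lim: "(\<lambda>n. 2 * pi * a n * exp (- 2 * A / saddle n) / sqrt (saddle n))
      \<longlonglongrightarrow> \<kappa> / sqrt 2 * sqrt (pi / A)"
    by (simp only: tendsto_of_real_iff)
  have L: "\<kappa> / sqrt 2 * sqrt (pi / A) = \<kappa> * sqrt (6 / pi)"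
  proof -
    have "pi / A = 2 * (6 / pi)" by (simp add: A_def power2_eq_square)
    then have "sqrt (pi / A) = sqrt 2 * sqrt (6 / pi)" by (simp only: real_sqrt_mult)
    then show ?thesis by simp
  qed
  show ?thesis
    unfolding a_def[symmetric]
  proof (rule asymp_equivI')
    let ?h = "\<lambda>n. \<kappa> * 3 powr (1 / 4) / (2 * pi * real n powr (1 / 4)) * exp (pi * sqrt (real n / 3))"
    have "(\<lambda>n. 2 * pi * a n * exp (- 2 * A / saddle n) / sqrt (saddle n) / (\<kappa> * sqrt (6 / pi)))
        \<longlonglongrightarrow> (\<kappa> * sqrt (6 / pi)) / (\<kappa> * sqrt (6 / pi))"
      using \<kappa> lim unfolding L by (intro tendsto_divide tendsto_const) auto
    then have "(\<lambda>n. 2 * pi * a n * exp (- 2 * A / saddle n) / sqrt (saddle n) / (\<kappa> * sqrt (6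
        / pi))) \<longlonglongrightarrow> 1"
      using \<kappa> by simp
    moreover have "\<forall>\<^sub>F n in sequentially. 2 * pi * a n * exp (- 2 * A / saddle n)
        / sqrt (saddle n) / (\<kappa> * sqrt (6 / pi)) = a n / ?h n"
      using eventually_gt_at_top[of 0]
    proof eventually_elim
      case (elim n)
      have sqrt36: "sqrt 36 = (6::real)" by (rule real_sqrt_unique) simp_all
      have "2 * A / saddle n = pi * sqrt (real n / 3)"
      proof -
        have "2 * A / saddle n = pi * (sqrt (12 * real n) / 6)"
          by (simp add: A_def saddle_def power2_eq_square)
        also have "sqrt (12 * real n) / 6 = sqrt (12 * real n / 36)"
            by (simp only: real_sqrt_divide sqrt36)
        finally show ?thesis by simp
      qed
      then have 1: "exp (- 2 * A / saddle n) = 1 / exp (pi * sqrt (real n / 3))"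
        by (simp add: exp_minus inverse_eq_divide)
      have 2: "sqrt (saddle n) * sqrt (6 / pi) * real n powr (1 / 4) = 3 powr (1 / 4)"
      proof -
        have "sqrt (saddle n) * sqrt (6 / pi) = sqrt (6 / sqrt (12 * real n))"
          by (simp add: saddle_def flip: real_sqrt_mult)
        also have "6 / sqrt (12 * real n) = sqrt (36 / (12 * real n))"
            by (simp only: real_sqrt_divide sqrt36)
        also have "36 / (12 * real n) = 3 / real n" by simp
        also have "sqrt (sqrt (3 / real n)) = (3 / real n) powr (1 / 4)"
        proof -
          have "(3 / real n) powr (1 / 4) = ((3 / real n) powr (1 / 2)) powr (1 / 2)"
            unfolding powr_powr by simp
          also have "\<dots> = sqrt (sqrt (3 / real n))" by (simp add: powr_half_sqrt)
          finally show ?thesis ..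
        qed
        finally show ?thesis using elim by (simp add: powr_divide)
      qed
      have p: "0 < sqrt (saddle n)" "0 < sqrt (6 / pi)" "0 < real n powr (1 / 4)" "0 < exp (pi
          * sqrt (real n / 3))"
        using elim saddle_bounds by auto
      have frac: "2 * pi * x * (1 / e) / s / (\<kappa> * r) = x / (\<kappa> * (s * r * m) / (2 * pi * m) * e)"
        if "0 < s" "0 < r" "0 < m" "0 < e" for x e s r m :: real
        using that \<kappa> by (simp add: field_simps)
      show ?case unfolding 1 2[symmetric] by (rule frac[OF p])
    qed
    ultimately show "(\<lambda>n. a n / ?h n) \<longlonglongrightarrow> 1" by (rule Lim_transform_eventually)
  qed
qed

section \<open>Poles of the weights and the two asymptotics\<close>

lemma progression_power_sums:
  fixes q :: complex
  assumes q: "norm q < 1" and m: "0 < m"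
  shows "(\<lambda>k. of_real (of_bool (r \<le> k \<and> m dvd (k - r))) * q ^ k) sums (q ^ r / (1 - q ^ m))"
proof -
  let ?f = "\<lambda>k. complex_of_real (of_bool (r \<le> k \<and> m dvd (k - r))) * q ^ k"
  have nm: "norm (q ^ m) < 1" using q m by (simp add: norm_power power_less_one_iff)
  have "(\<lambda>j. q ^ r * (q ^ m) ^ j) sums (q ^ r * (1 / (1 - q ^ m)))"
    by (intro sums_mult geometric_sums nm)
  moreover have "(\<lambda>j. q ^ r * (q ^ m) ^ j) = (\<lambda>j. ?f (r + m * j))"
    by (simp add: power_add power_mult)
  ultimately have "(\<lambda>j. ?f (r + m * j)) sums (q ^ r / (1 - q ^ m))" by simp
  moreover have "strict_mono (\<lambda>j. r + m * j)" using m by (simp add: strict_mono_def)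
  moreover have "?f k = 0" if "k \<notin> range (\<lambda>j. r + m * j)" for k
  proof -
    have "\<not> (r \<le> k \<and> m dvd (k - r))"
    proof
      assume "r \<le> k \<and> m dvd (k - r)"
      then obtain j where "k = r + m * j" by (metis dvdE le_add_diff_inverse)
      with that show False by auto
    qed
    then show ?thesis by (simp only: of_bool_eq of_real_0 mult_zero_left)
  qed
  ultimately show ?thesis using sums_mono_reindex[of "\<lambda>j. r + m * j" ?f] by blast
qed

text \<open>The factor \<open>(1 - exp (- m * z)) / z\<close> is a difference quotient and
  tends to \<open>m\<close>.\<close>

lemma progression_pole:
  assumes m: "0 < m"
  shows "((\<lambda>z. z * (exp (- z) ^ r / (1 - exp (- z) ^ m))) \<longlongrightarrow> 1 / of_nat m) (at (0::complex) within S)"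
proof -
  have e: "exp (- z) ^ k = exp (- (of_nat k * z))" for z :: complex and k
    by (simp add: exp_of_nat_mult[symmetric])
  have "((\<lambda>z::complex. 1 - exp (- (of_nat m * z))) has_field_derivative of_nat m) (at 0)"
    by (auto intro!: derivative_eq_intros)
  then have "((\<lambda>z::complex. (1 - exp (- (of_nat m * z))) / z) \<longlongrightarrow> of_nat m) (at 0)"
    by (simp add: has_field_derivative_iff)
  then have "((\<lambda>z::complex. inverse ((1 - exp (- (of_nat m * z))) / z)) \<longlongrightarrow> inverse (of_nat m)) (at 0)"
    by (rule tendsto_inverse) (use m in simp)
  moreover have "((\<lambda>z::complex. exp (- (of_nat r * z))) \<longlongrightarrow> exp (- (of_nat r * 0))) (at 0)"
    by (intro tendsto_intros)
  ultimately have "((\<lambda>z::complex. inverse ((1 - exp (- (of_nat m * z))) / z) * exp (- (of_nat r * z)))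
      \<longlongrightarrow> inverse (of_nat m) * exp (- (of_nat r * 0))) (at 0)"
    by (rule tendsto_mult)
  moreover have "inverse ((1 - exp (- (of_nat m * z))) / z) * exp (- (of_nat r * z))
      = z * (exp (- z) ^ r / (1 - exp (- z) ^ m))" for z :: complex
    by (simp add: e divide_inverse mult_ac)
  ultimately have "((\<lambda>z. z * (exp (- z) ^ r / (1 - exp (- z) ^ m))) \<longlongrightarrow> 1 / of_nat m) (at (0::complex))"
    by (simp add: inverse_eq_divide)
  then show ?thesis by (rule tendsto_within_subset) simp
qed

text \<open>Replaces the sum of the series by its closed form, which is available for \<open>0 < Re
  z\<close> only; hence the limit is taken within the right half-plane.\<close>

lemma pole_of_series:
  fixes c :: "nat \<Rightarrow> real"
  assumes "\<And>q::complex. norm q < 1 \<Longrightarrow> (\<lambda>k. of_real (c k) * q ^ k) sums R q"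
    and "((\<lambda>z. z * R (exp (- z))) \<longlongrightarrow> l) (at 0 within {z. 0 < Re z})"
  shows "((\<lambda>z. z * (\<Sum>k. of_real (c k) * exp (- z) ^ k)) \<longlongrightarrow> l) (at 0 within {z. 0 < Re z})"
proof -
  have "(\<Sum>k. of_real (c k) * exp (- z) ^ k) = R (exp (- z))" if "0 < Re z" for z
    using assms(1)[of "exp (- z)"] that by (simp add: sums_iff)
  then have "\<forall>\<^sub>F z in at 0 within {z. 0 < Re z}. z * R (exp (- z))
      = z * (\<Sum>k. of_real (c k) * exp (- z) ^ k)"
    by (auto simp: eventually_at_filter)
  then show ?thesis by (rule Lim_transform_eventually[OF assms(2)])
qed

theorem theorem5p1:
  shows "(\<lambda>n. real (a2 n)) \<sim>[at_top]
           (\<lambda>n. 3 powr (5 / 4) / (8 * pi * real n powr (1 / 4)) * exp (pi * sqrt (real n / 3)))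
       \<and> (\<lambda>n. real (b2 n)) \<sim>[at_top]
           (\<lambda>n. 3 powr (1 / 4) / (4 * pi * real n powr (1 / 4)) * exp (pi * sqrt (real n / 3)))"
proof
  \<comment> \<open>the weights of the convolution, with both conditions rewritten as arithmetic
    progressions\<close>
  define ca :: "nat \<Rightarrow> real" where
    "ca = (\<lambda>k. of_bool (3 \<le> k \<and> 2 dvd (k - 3)) + of_bool (2 \<le> k \<and> 4 dvd (k - 2)))"
  have ca: "of_bool (odd k \<and> 3 \<le> k) + of_bool (even k \<and> odd (k div 2)) = ca k" for k
  proof -
    have "odd k \<and> 3 \<le> k \<longleftrightarrow> 3 \<le> k \<and> 2 dvd (k - 3)" by presburger
    moreover have "even k \<and> odd (k div 2) \<longleftrightarrow> 2 \<le> k \<and> 4 dvd (k - 2)" by presburger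
    ultimately show ?thesis by (simp only: ca_def)
  qed
  have "((\<lambda>z. z * (exp (- z) ^ 3 / (1 - exp (- z) ^ 2)) + z * (exp (- z) ^ 2 / (1 - exp (- z) ^ 4)))
      \<longlongrightarrow> 1 / of_nat 2 + 1 / of_nat 4) (at (0::complex) within {z. 0 < Re z})"
    by (intro tendsto_add progression_pole) auto
  then have pole: "((\<lambda>z. z * (exp (- z) ^ 3 / (1 - exp (- z) ^ 2) + exp (- z) ^ 2 / (1
      - exp (- z) ^ 4)))
      \<longlongrightarrow> of_real (3 / 4)) (at (0::complex) within {z. 0 < Re z})"
    by (simp add: distrib_left)
  have "(\<lambda>n. \<Sum>k\<le>n. ca k * real (odd_count (n - k))) \<sim>[at_top]
     (\<lambda>n. 3 / 4 * 3 powr (1 / 4) / (2 * pi * real n powr (1 / 4)) * exp (pi * sqrt (real n / 3)))"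
  proof (rule convolution_asymptotics[where B = 2])
    show "((\<lambda>z. z * (\<Sum>k. of_real (ca k) * exp (- z) ^ k)) \<longlongrightarrow> of_real (3
        / 4)) (at 0 within {z. 0 < Re z})"
    proof (rule pole_of_series[OF _ pole])
      fix q :: complex assume q: "norm q < 1"
      show "(\<lambda>k. of_real (ca k) * q ^ k) sums (q ^ 3 / (1 - q ^ 2) + q ^ 2 / (1 - q ^ 4))"
        unfolding ca_def of_real_add distrib_right by (intro sums_add progression_power_sums q) auto
    qed
  qed (use odd_count_sums in \<open>auto simp: ca_def\<close>)
  moreover have "real (a2 n) = (\<Sum>k\<le>n. ca k * real (odd_count (n - k)))" for n
    unfolding a2_eq_convolution of_nat_sum of_nat_mult of_nat_add of_nat_of_bool ca ..
  moreover have "3 / 4 * 3 powr (1 / 4) / (2 * pi * x) = 3 powr (5 / 4) / (8 * pi * x)" for x :: real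
  proof -
    have "3 powr (5 / 4) = 3 powr (1 + 1 / 4 :: real)" by simp
    also have "\<dots> = 3 * 3 powr (1 / 4)" by (subst powr_add) simp
    finally show ?thesis by simp
  qed
  ultimately show "(\<lambda>n. real (a2 n)) \<sim>[at_top]
           (\<lambda>n. 3 powr (5 / 4) / (8 * pi * real n powr (1 / 4)) * exp (pi * sqrt (real n / 3)))"
    by (simp only:)
next
  define cb :: "nat \<Rightarrow> real" where "cb = (\<lambda>k. of_bool (2 \<le> k \<and> 2 dvd (k - 2)))"
  have cb: "of_bool (even k \<and> 2 \<le> k) = cb k" for k
  proof -
    have "even k \<and> 2 \<le> k \<longleftrightarrow> 2 \<le> k \<and> 2 dvd (k - 2)" by presburger
    then show ?thesis by (simp only: cb_def)
  qed
  have "((\<lambda>z. z * (exp (- z) ^ 2 / (1 - exp (- z) ^ 2))) \<longlongrightarrow> 1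
      / of_nat 2) (at (0::complex) within {z. 0 < Re z})"
    by (rule progression_pole) auto
  then have pole: "((\<lambda>z. z * (exp (- z) ^ 2 / (1 - exp (- z) ^ 2))) \<longlongrightarrow> of_real (1
      / 2)) (at (0::complex) within {z. 0 < Re z})"
    by simp
  have "(\<lambda>n. \<Sum>k\<le>n. cb k * real (distinct_count (n - k))) \<sim>[at_top]
     (\<lambda>n. 1 / 2 * 3 powr (1 / 4) / (2 * pi * real n powr (1 / 4)) * exp (pi * sqrt (real n / 3)))"
  proof (rule convolution_asymptotics[where B = 1])
    show "((\<lambda>z. z * (\<Sum>k. of_real (cb k) * exp (- z) ^ k)) \<longlongrightarrow> of_real (1
        / 2)) (at 0 within {z. 0 < Re z})"
    proof (rule pole_of_series[OF _ pole])
      fix q :: complex assume q: "norm q < 1"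
      show "(\<lambda>k. of_real (cb k) * q ^ k) sums (q ^ 2 / (1 - q ^ 2))"
        unfolding cb_def by (intro progression_power_sums q) auto
    qed
  qed (use distinct_count_sums in \<open>auto simp: cb_def\<close>)
  moreover have "real (b2 n) = (\<Sum>k\<le>n. cb k * real (distinct_count (n - k)))" for n
    unfolding b2_eq_convolution of_nat_sum of_nat_mult of_nat_of_bool cb ..
  moreover have "1 / 2 * 3 powr (1 / 4) / (2 * pi * x) = 3 powr (1 / 4) / (4 * pi * x)" for x :: real
    by simp
  ultimately show "(\<lambda>n. real (b2 n)) \<sim>[at_top]
           (\<lambda>n. 3 powr (1 / 4) / (4 * pi * real n powr (1 / 4)) * exp (pi * sqrt (real n / 3)))"
    by (simp only:)
qed

end
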